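(* Let $M^{2n+s}(f,Q,\xi_i,\eta^i,g)$ be a weak $\beta f$-Kenmotsu manifold with $\beta=\mathrm{const}\ne0$, and suppose that $(g,V)$ represents a $\ast$-$\eta$-Ricci soliton on $M$ with constants $\lambda,\mu\in\mathbb{R}$, that is, $V$ is a vector field on $M$ and $$\tfrac12\,\pounds_V g+\mathrm{Ric}^\ast=\lambda\Big\{g-\sum_i\eta^i\otimes\eta^i\Big\}+(\lambda+\mu)\,\bar\eta\otimes\bar\eta .$$ Then the soliton constants satisfy $\lambda+\mu=0$.
   Context: A weak metric $f$-structure on a smooth manifold $M^{2n+s}$ ($n>0$, $s>1$) is a set $(f,Q,\xi_i,\eta^i,g)$, where $f$ is a skew-symmetric $(1,1)$-tensor of rank $2n$, $Q$ is a self-adjoint nonsingular $(1,1)$-tensor, $\xi_i$ ($1\le i\le s$) are orthonormal vector fields, $\eta^i$ are dual 1-forms, and $g$ is a Riemannian metric, such that $f^2=-Q+\sum_i\eta^i\otimes\xi_i$, $\eta^i(\xi_j)=\delta^i_j$, $Q\xi_i=\xi_i$, and $g(fX,fY)=g(X,QY)-\sum_i\eta^i(X)\eta^i(Y)$ for all vector fields $X,Y$. Put $\bar\xi=\sum_i\xi_i$, $\bar\eta=\sum_i\eta^i$. The structure is normal if $[f,f](X,Y)+2\sum_i d\eta^i(X,Y)\,\xi_i=0$ for all $X,Y$, where $[f,f](X,Y)=f^2[X,Y]+[fX,fY]-f[fX,Y]-f[X,fY]$ and $d\omega(X,Y)=\tfrac12\{X(\omega(Y))-Y(\omega(X))-\omega([X,Y])\}$.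 A weak $\beta f$-Kenmotsu manifold is a weak metric $f$-manifold, normal (i.e. $[f,f](X,Y)+2\sum_i d\eta^i(X,Y)\,\xi_i=0$ for all vector fields $X,Y$), satisfying $(\nabla_Xf)Y=\beta\{g(fX,Y)\,\bar\xi-\bar\eta(Y)fX\}$ for all $X,Y$, where $\nabla$ is the Levi-Civita connection of $g$. Conventions: $R_{X,Y}=[\nabla_X,\nabla_Y]-\nabla_{[X,Y]}$; the $\ast$-Ricci tensor is $\mathrm{Ric}^\ast(X,Y)=\tfrac12\,\mathrm{trace}\{Z\mapsto R_{X,fY}fZ\}$; $\pounds$ is the Lie derivative. *)

theory Defs
  imports "HOL-Analysis.Analysis"
begin

section \<open>Smooth maps between Euclidean spaces\<close>

text \<open>Only meaningful for open \<open>S\<close>, since the derivative is the unrestricted one at each point.\<close>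

primrec Ck_on ::
  "nat \<Rightarrow> 'a::euclidean_space set \<Rightarrow> ('a \<Rightarrow> 'b::real_normed_vector) \<Rightarrow> bool" where
  "Ck_on 0 S h \<longleftrightarrow> continuous_on S h"
| "Ck_on (Suc k) S h \<longleftrightarrow>
     (\<forall>x\<in>S. h differentiable at x) \<and> (\<forall>v. Ck_on k S (\<lambda>x. frechet_derivative h (at x) v))"

definition smooth_on :: "'a::euclidean_space set \<Rightarrow> ('a \<Rightarrow> 'b::real_normed_vector) \<Rightarrow> bool" where
  "smooth_on S h \<longleftrightarrow> (\<forall>k. Ck_on k S h)"


section \<open>Smooth manifolds\<close>

text \<open>
  A manifold of dimension \<open>CARD('d)\<close> is a Hausdorff, second countable type \<open>'m\<close> with a smooth
  atlas \<open>A\<close>, not necessarily maximal.  A chart is a pair of its domain and its coordinate map.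
\<close>

type_synonym ('m, 'd) chart = "'m set \<times> ('m \<Rightarrow> real ^ 'd)"

definition chart_inv :: "('m, 'd) chart \<Rightarrow> real ^ 'd \<Rightarrow> 'm" where
  "chart_inv c = inv_into (fst c) (snd c)"

definition smooth_atlas ::
  "('m::{t2_space,second_countable_topology}, 'd::finite) chart set \<Rightarrow> bool" where
  "smooth_atlas A \<longleftrightarrow>
     (\<Union>c\<in>A. fst c) = UNIV \<and>
     (\<forall>c\<in>A. open (fst c) \<and> open (snd c ` fst c) \<and>
        homeomorphism (fst c) (snd c ` fst c) (snd c) (chart_inv c)) \<and>
     (\<forall>c\<in>A. \<forall>c'\<in>A. smooth_on (snd c ` (fst c \<inter> fst c')) (snd c' \<circ> chart_inv c))"

definition smooth_fun :: "('m, 'd::finite) chart set \<Rightarrow> ('m \<Rightarrow> real) \<Rightarrow> bool" where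
  "smooth_fun A h \<longleftrightarrow> (\<forall>c\<in>A. smooth_on (snd c ` fst c) (h \<circ> chart_inv c))"

text \<open>
  Tangent spaces: at every point \<open>p\<close> one chart \<open>chart_at A p\<close> around \<open>p\<close> is fixed, and
  \<open>T\<^sub>pM\<close> is identified with \<open>real ^ 'd\<close> by means of its differential.  As no continuity of
  \<open>p \<mapsto> chart_at A p\<close> is available, components of a vector at \<open>p\<close> with respect to
  any other chart \<open>c\<close> have to be computed by \<open>dchart A c p\<close>, the differential of \<open>c\<close> at \<open>p\<close>;
  smoothness is always tested on these components.
\<close>

definition chart_at :: "('m, 'd) chart set \<Rightarrow> 'm \<Rightarrow> ('m, 'd) chart" where
  "chart_at A p = (SOME c. c \<in> A \<and> p \<in> fst c)"

definition dchart ::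
  "('m, 'd::finite) chart set \<Rightarrow> ('m, 'd) chart \<Rightarrow> 'm \<Rightarrow> real ^ 'd \<Rightarrow> real ^ 'd" where
  "dchart A c p =
     frechet_derivative (snd c \<circ> chart_inv (chart_at A p)) (at (snd (chart_at A p) p))"

text \<open>With respect to the distinguished chart itself a vector is its own coordinate vector.\<close>

lemma chart_at_props:
  assumes "smooth_atlas A"
  shows "chart_at A p \<in> A \<and> p \<in> fst (chart_at A p)"
proof -
  have "p \<in> (\<Union>c\<in>A. fst c)" using assms by (simp add: smooth_atlas_def)
  then have "\<exists>c. c \<in> A \<and> p \<in> fst c" by blast
  then show ?thesis unfolding chart_at_def by (rule someI_ex)
qed

lemma dchart_chart_at:
  assumes "smooth_atlas A"
  shows "dchart A (chart_at A p) p = (\<lambda>v. v)"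
proof -
  let ?c = "chart_at A p"
  let ?S = "snd ?c ` fst ?c"
  have c: "?c \<in> A" "p \<in> fst ?c" using chart_at_props[OF assms] by auto
  have op: "open ?S" and ho: "homeomorphism (fst ?c) ?S (snd ?c) (chart_inv ?c)"
    using assms c(1) unfolding smooth_atlas_def by auto
  have "((\<lambda>v. v) has_derivative (\<lambda>v. v)) (at (snd ?c p))" by simp
  then have "((snd ?c \<circ> chart_inv ?c) has_derivative (\<lambda>v. v)) (at (snd ?c p))"
    by (rule has_derivative_transform_within_open[OF _ op])
       (use c(2) ho in \<open>auto simp: homeomorphism_def\<close>)
  then show ?thesis unfolding dchart_def by (rule frechet_derivative_at[symmetric])
qed


section \<open>Vector fields and tensor fields\<close>

type_synonym ('m, 'd) vfield = "'m \<Rightarrow> real ^ 'd"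
type_synonym ('m, 'd) endo = "'m \<Rightarrow> real ^ 'd \<Rightarrow> real ^ 'd"
type_synonym ('m, 'd) form1 = "'m \<Rightarrow> real ^ 'd \<Rightarrow> real"
type_synonym ('m, 'd) form2 = "'m \<Rightarrow> real ^ 'd \<Rightarrow> real ^ 'd \<Rightarrow> real"
type_synonym ('m, 'd) conn = "('m, 'd) vfield \<Rightarrow> ('m, 'd) vfield \<Rightarrow> ('m, 'd) vfield"

definition vf_rep ::
  "('m, 'd::finite) chart set \<Rightarrow> ('m, 'd) chart \<Rightarrow> ('m, 'd) vfield \<Rightarrow> real ^ 'd \<Rightarrow> real ^ 'd" where
  "vf_rep A c X y = dchart A c (chart_inv c y) (X (chart_inv c y))"

definition smooth_vf :: "('m, 'd::finite) chart set \<Rightarrow> ('m, 'd) vfield \<Rightarrow> bool" where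
  "smooth_vf A X \<longleftrightarrow> (\<forall>c\<in>A. smooth_on (snd c ` fst c) (vf_rep A c X))"

definition vf_app ::
  "('m, 'd::finite) chart set \<Rightarrow> ('m, 'd) vfield \<Rightarrow> ('m \<Rightarrow> real) \<Rightarrow> 'm \<Rightarrow> real" where
  "vf_app A X h p =
     frechet_derivative (h \<circ> chart_inv (chart_at A p)) (at (snd (chart_at A p) p)) (X p)"

definition bracket :: "('m, 'd::finite) chart set \<Rightarrow> ('m, 'd) conn" where
  "bracket A X Y p =
     (let c = chart_at A p; y = snd c p in
        frechet_derivative (vf_rep A c Y) (at y) (X p)
      - frechet_derivative (vf_rep A c X) (at y) (Y p))"

definition tensor11 :: "('m, 'd::finite) chart set \<Rightarrow> ('m, 'd) endo \<Rightarrow> bool" where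
  "tensor11 A T \<longleftrightarrow> (\<forall>p. linear (T p)) \<and>
     (\<forall>X. smooth_vf A X \<longrightarrow> smooth_vf A (\<lambda>p. T p (X p)))"

definition one_form :: "('m, 'd::finite) chart set \<Rightarrow> ('m, 'd) form1 \<Rightarrow> bool" where
  "one_form A \<omega> \<longleftrightarrow> (\<forall>p. linear (\<omega> p)) \<and>
     (\<forall>X. smooth_vf A X \<longrightarrow> smooth_fun A (\<lambda>p. \<omega> p (X p)))"

definition riemannian_metric :: "('m, 'd::finite) chart set \<Rightarrow> ('m, 'd) form2 \<Rightarrow> bool" where
  "riemannian_metric A g \<longleftrightarrow>
     (\<forall>p. bilinear (g p)) \<and>
     (\<forall>p x y. g p x y = g p y x) \<and>
     (\<forall>p x. x \<noteq> 0 \<longrightarrow> g p x x > 0) \<and>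
     (\<forall>X Y. smooth_vf A X \<and> smooth_vf A Y \<longrightarrow> smooth_fun A (\<lambda>p. g p (X p) (Y p)))"

definition ext_deriv ::
  "('m, 'd::finite) chart set \<Rightarrow> ('m, 'd) form1 \<Rightarrow> ('m, 'd) vfield \<Rightarrow> ('m, 'd) vfield \<Rightarrow> 'm \<Rightarrow> real"
  where
  "ext_deriv A \<omega> X Y p =
     (vf_app A X (\<lambda>q. \<omega> q (Y q)) p - vf_app A Y (\<lambda>q. \<omega> q (X q)) p - \<omega> p (bracket A X Y p)) / 2"

definition lie_deriv2 ::
  "('m, 'd::finite) chart set \<Rightarrow> ('m, 'd) vfield \<Rightarrow> ('m, 'd) form2 \<Rightarrow>
   ('m, 'd) vfield \<Rightarrow> ('m, 'd) vfield \<Rightarrow> 'm \<Rightarrow> real" where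
  "lie_deriv2 A V g X Y p =
     vf_app A V (\<lambda>q. g q (X q) (Y q)) p
     - g p (bracket A V X p) (Y p) - g p (X p) (bracket A V Y p)"


section \<open>Levi-Civita connection, curvature and traces\<close>

definition affine_connection :: "('m, 'd::finite) chart set \<Rightarrow> ('m, 'd) conn \<Rightarrow> bool" where
  "affine_connection A D \<longleftrightarrow>
     (\<forall>X Y. smooth_vf A X \<and> smooth_vf A Y \<longrightarrow> smooth_vf A (D X Y)) \<and>
     (\<forall>X X' Y. smooth_vf A X \<and> smooth_vf A X' \<and> smooth_vf A Y \<longrightarrow>
        (\<forall>p. D (\<lambda>q. X q + X' q) Y p = D X Y p + D X' Y p)) \<and>
     (\<forall>h X Y. smooth_fun A h \<and> smooth_vf A X \<and> smooth_vf A Y \<longrightarrow>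
        (\<forall>p. D (\<lambda>q. h q *\<^sub>R X q) Y p = h p *\<^sub>R D X Y p)) \<and>
     (\<forall>X Y Y'. smooth_vf A X \<and> smooth_vf A Y \<and> smooth_vf A Y' \<longrightarrow>
        (\<forall>p. D X (\<lambda>q. Y q + Y' q) p = D X Y p + D X Y' p)) \<and>
     (\<forall>h X Y. smooth_fun A h \<and> smooth_vf A X \<and> smooth_vf A Y \<longrightarrow>
        (\<forall>p. D X (\<lambda>q. h q *\<^sub>R Y q) p = vf_app A X h p *\<^sub>R Y p + h p *\<^sub>R D X Y p))"

definition levi_civita ::
  "('m, 'd::finite) chart set \<Rightarrow> ('m, 'd) form2 \<Rightarrow> ('m, 'd) conn \<Rightarrow> bool" where
  "levi_civita A g D \<longleftrightarrow>
     affine_connection A D \<and>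
     (\<forall>X Y. smooth_vf A X \<and> smooth_vf A Y \<longrightarrow>
        (\<forall>p. D X Y p - D Y X p = bracket A X Y p)) \<and>
     (\<forall>X Y Z. smooth_vf A X \<and> smooth_vf A Y \<and> smooth_vf A Z \<longrightarrow>
        (\<forall>p. vf_app A X (\<lambda>q. g q (Y q) (Z q)) p = g p (D X Y p) (Z p) + g p (Y p) (D X Z p)))"

definition curvature ::
  "('m, 'd::finite) chart set \<Rightarrow> ('m, 'd) conn \<Rightarrow>
   ('m, 'd) vfield \<Rightarrow> ('m, 'd) vfield \<Rightarrow> ('m, 'd) vfield \<Rightarrow> ('m, 'd) vfield" where
  "curvature A D X Y Z p = D X (D Y Z) p - D Y (D X Z) p - D (bracket A X Y) Z p"

definition cov_deriv11 ::
  "('m, 'd) conn \<Rightarrow> ('m, 'd) endo \<Rightarrow> ('m, 'd) vfield \<Rightarrow> ('m, 'd) vfield \<Rightarrow> 'm \<Rightarrow> real ^ 'd" where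
  "cov_deriv11 D T X Y p = D X (\<lambda>q. T q (Y q)) p - T p (D X Y p)"

text \<open>
  An operator \<open>\<Phi>\<close> on vector fields that is linear over the smooth functions induces the
  endomorphism \<open>Z\<^sub>p \<mapsto> (\<Phi> Z)\<^sub>p\<close> of each \<open>T\<^sub>pM\<close>, which is independent of the
  chosen extension \<open>Z\<close> of \<open>Z\<^sub>p\<close>; its trace is the function \<open>vf_trace A \<Phi>\<close>.
\<close>

definition endo_at ::
  "('m, 'd::finite) chart set \<Rightarrow> (('m, 'd) vfield \<Rightarrow> ('m, 'd) vfield) \<Rightarrow> ('m, 'd) endo" where
  "endo_at A \<Phi> p z = \<Phi> (SOME Z. smooth_vf A Z \<and> Z p = z) p"

definition vf_trace ::
  "('m, 'd::finite) chart set \<Rightarrow> (('m, 'd) vfield \<Rightarrow> ('m, 'd) vfield) \<Rightarrow> 'm \<Rightarrow> real" where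
  "vf_trace A \<Phi> p = trace (matrix (endo_at A \<Phi> p))"

definition star_ricci ::
  "('m, 'd::finite) chart set \<Rightarrow> ('m, 'd) conn \<Rightarrow> ('m, 'd) endo \<Rightarrow>
   ('m, 'd) vfield \<Rightarrow> ('m, 'd) vfield \<Rightarrow> 'm \<Rightarrow> real" where
  "star_ricci A D f X Y p =
     vf_trace A (\<lambda>Z. curvature A D X (\<lambda>q. f q (Y q)) (\<lambda>q. f q (Z q))) p / 2"


section \<open>Weak metric f-structures\<close>

text \<open>
  The index \<open>i\<close> of \<open>\<xi> i\<close> and \<open>\<eta> i\<close> ranges over \<open>{1..s}\<close>.
\<close>

definition weak_metric_f_structure ::
  "('m::{t2_space,second_countable_topology}, 'd::finite) chart set \<Rightarrow> nat \<Rightarrow> nat \<Rightarrow>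
   ('m, 'd) endo \<Rightarrow> ('m, 'd) endo \<Rightarrow> (nat \<Rightarrow> ('m, 'd) vfield) \<Rightarrow> (nat \<Rightarrow> ('m, 'd) form1) \<Rightarrow>
   ('m, 'd) form2 \<Rightarrow> bool" where
  "weak_metric_f_structure A n s f Q \<xi> \<eta> g \<longleftrightarrow>
     smooth_atlas A \<and> n > 0 \<and> s > 1 \<and> CARD('d) = 2 * n + s \<and>
     riemannian_metric A g \<and>
     tensor11 A f \<and> (\<forall>p x y. g p (f p x) y = - g p x (f p y)) \<and>
       (\<forall>p. dim (range (f p)) = 2 * n) \<and>
     tensor11 A Q \<and> (\<forall>p x y. g p (Q p x) y = g p x (Q p y)) \<and> (\<forall>p. bij (Q p)) \<and>
     (\<forall>i\<in>{1..s}. smooth_vf A (\<xi> i)) \<and>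
     (\<forall>i\<in>{1..s}. one_form A (\<eta> i)) \<and>
     (\<forall>i\<in>{1..s}. \<forall>j\<in>{1..s}. \<forall>p. g p (\<xi> i p) (\<xi> j p) = (if i = j then 1 else 0)) \<and>
     (\<forall>p x. f p (f p x) = - Q p x + (\<Sum>i\<in>{1..s}. \<eta> i p x *\<^sub>R \<xi> i p)) \<and>
     (\<forall>i\<in>{1..s}. \<forall>j\<in>{1..s}. \<forall>p. \<eta> i p (\<xi> j p) = (if i = j then 1 else 0)) \<and>
     (\<forall>i\<in>{1..s}. \<forall>p. Q p (\<xi> i p) = \<xi> i p) \<and>
     (\<forall>p x y. g p (f p x) (f p y) = g p x (Q p y) - (\<Sum>i\<in>{1..s}. \<eta> i p x * \<eta> i p y))"

definition xi_bar :: "nat \<Rightarrow> (nat \<Rightarrow> ('m, 'd::finite) vfield) \<Rightarrow> ('m, 'd) vfield" where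
  "xi_bar s \<xi> p = (\<Sum>i\<in>{1..s}. \<xi> i p)"

definition eta_bar :: "nat \<Rightarrow> (nat \<Rightarrow> ('m, 'd) form1) \<Rightarrow> ('m, 'd) form1" where
  "eta_bar s \<eta> p x = (\<Sum>i\<in>{1..s}. \<eta> i p x)"

definition nijenhuis ::
  "('m, 'd::finite) chart set \<Rightarrow> ('m, 'd) endo \<Rightarrow>
   ('m, 'd) vfield \<Rightarrow> ('m, 'd) vfield \<Rightarrow> ('m, 'd) vfield" where
  "nijenhuis A f X Y p =
     f p (f p (bracket A X Y p))
     + bracket A (\<lambda>q. f q (X q)) (\<lambda>q. f q (Y q)) p
     - f p (bracket A (\<lambda>q. f q (X q)) Y p)
     - f p (bracket A X (\<lambda>q. f q (Y q)) p)"

definition normal_structure ::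
  "('m, 'd::finite) chart set \<Rightarrow> nat \<Rightarrow> ('m, 'd) endo \<Rightarrow> (nat \<Rightarrow> ('m, 'd) vfield) \<Rightarrow>
   (nat \<Rightarrow> ('m, 'd) form1) \<Rightarrow> bool" where
  "normal_structure A s f \<xi> \<eta> \<longleftrightarrow>
     (\<forall>X Y. smooth_vf A X \<and> smooth_vf A Y \<longrightarrow>
        (\<forall>p. nijenhuis A f X Y p
           + 2 *\<^sub>R (\<Sum>i\<in>{1..s}. ext_deriv A (\<eta> i) X Y p *\<^sub>R \<xi> i p) = 0))"

text \<open>
  \<open>\<nabla>\<close> is passed as the argument \<open>D\<close>, characterised by \<open>levi_civita A g D\<close>; on smooth vector
  fields it is uniquely determined by \<open>g\<close>.  The function \<open>\<beta>\<close> is a constant here.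
\<close>

definition weak_beta_f_kenmotsu ::
  "('m::{t2_space,second_countable_topology}, 'd::finite) chart set \<Rightarrow> nat \<Rightarrow> nat \<Rightarrow>
   ('m, 'd) endo \<Rightarrow> ('m, 'd) endo \<Rightarrow> (nat \<Rightarrow> ('m, 'd) vfield) \<Rightarrow> (nat \<Rightarrow> ('m, 'd) form1) \<Rightarrow>
   ('m, 'd) form2 \<Rightarrow> ('m, 'd) conn \<Rightarrow> real \<Rightarrow> bool" where
  "weak_beta_f_kenmotsu A n s f Q \<xi> \<eta> g D \<beta> \<longleftrightarrow>
     weak_metric_f_structure A n s f Q \<xi> \<eta> g \<and>
     normal_structure A s f \<xi> \<eta> \<and>
     levi_civita A g D \<and>
     (\<forall>X Y. smooth_vf A X \<and> smooth_vf A Y \<longrightarrow>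
        (\<forall>p. cov_deriv11 D f X Y p =
           \<beta> *\<^sub>R (g p (f p (X p)) (Y p) *\<^sub>R xi_bar s \<xi> p - eta_bar s \<eta> p (Y p) *\<^sub>R f p (X p))))"

definition star_eta_ricci_soliton ::
  "('m, 'd::finite) chart set \<Rightarrow> nat \<Rightarrow> ('m, 'd) endo \<Rightarrow> (nat \<Rightarrow> ('m, 'd) form1) \<Rightarrow>
   ('m, 'd) form2 \<Rightarrow> ('m, 'd) conn \<Rightarrow> ('m, 'd) vfield \<Rightarrow> real \<Rightarrow> real \<Rightarrow> bool" where
  "star_eta_ricci_soliton A s f \<eta> g D V lam mu \<longleftrightarrow>
     smooth_vf A V \<and>
     (\<forall>X Y. smooth_vf A X \<and> smooth_vf A Y \<longrightarrow>
        (\<forall>p. (1 / 2) * lie_deriv2 A V g X Y p + star_ricci A D f X Y p =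
           lam * (g p (X p) (Y p) - (\<Sum>i\<in>{1..s}. \<eta> i p (X p) * \<eta> i p (Y p)))
           + (lam + mu) * (eta_bar s \<eta> p (X p) * eta_bar s \<eta> p (Y p))))"

end

theory Submission
  imports Defs
begin

text \<open>
  Write \<open>\<P>\<close> for the orthogonal projection onto the image of \<open>f\<close>, \<open>\<gamma>\<close> for the restriction of \<open>g\<close> to it and
  \<open>K = s \<beta>\<close>.  Normality kills the normal connection form, so \<open>\<nabla>\<^sub>X \<xi>\<^sub>i = \<beta> \<P> X\<close>; hence along the sum \<open>\<xi>\<close> of
  the \<open>\<xi>\<^sub>i\<close> we have \<open>\<pounds> g = 2 K \<gamma>\<close>, \<open>\<pounds> f = 0\<close>, \<open>\<pounds> \<nabla> = - 2 K \<beta> \<gamma> \<otimes> \<xi>\<close>, and therefore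
  \<open>\<pounds> Ric* = - 2 K\<^sup>2 \<beta> g(f \<sqdot>, f \<sqdot>)\<close>.  Since \<open>\<pounds>\<close> scales both \<open>\<gamma>\<close> and \<open>g(f \<sqdot>, f \<sqdot>)\<close> by \<open>2 K\<close> on
  the image of \<open>f\<close>, applying \<open>\<pounds>\<close> twice to the soliton equation there eliminates the curvature:
  \<open>Z = U' + 2 K U\<close> with \<open>U = [\<xi>, V]\<close>, \<open>U' = [\<xi>, U]\<close> satisfies \<open>\<pounds>\<^sub>Z g = 0\<close> on the image of \<open>f\<close>.  The
  soliton equation in the direction of \<open>\<xi>\<close>, where \<open>Ric*\<close> vanishes, shows on the other hand that \<open>Z\<close>
  is orthogonal to the image of \<open>f\<close> and that \<open>\<pounds>\<^sub>Z g = 4 K \<beta> s\<^sup>2 (\<lambda> + \<mu>) \<gamma>\<close>.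
\<close>

subsection \<open>Calculus of smooth functions\<close>

text \<open>The star Ricci tensor is never computed, since the curvature on the image of
  \<open>f\<close> stays unknown and V is arbitrary. Known is only how the structure changes along
  the sum of the \<xi>'s; this is why the soliton equation is differentiated in that direction. One
  differentiation trades the curvature for tensors that the Lie derivative multiplies by 2 K; the
  combination U' + 2 K U is dictated by this eigenvalue. Being orthogonal to the image of
  \<open>f\<close>, Z is a combination of the \<xi>'s. Each \<xi> has covariant derivative \<beta> X
  along X in that image, so Z stretches the image by \<beta> times the sum of its coefficients,
  which is a nonzero multiple of \<lambda> + \<mu>. A second obstacle is the encoding: traces are
  defined by choosing a global extension of each tangent vector, and tangent spaces by choosing a
  chart at each point separately. Hence the preparation: bump functions provide extensions,
  linearity over smooth functions makes their choice irrelevant, and a formula for the derivative of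
  a trace lets the Lie derivative pass through it.\<close>

lemma has_derivative_frechet:
  "h differentiable at x \<Longrightarrow> (h has_derivative frechet_derivative h (at x)) (at x)"
  by (simp add: frechet_derivative_works)

lemma frechet_derivative_eqI:
  "(h has_derivative h') (at x) \<Longrightarrow> frechet_derivative h (at x) v = h' v"
  by (simp add: frechet_derivative_at[symmetric])

text \<open>The unrestricted derivative at a point sees a whole neighbourhood, which an open
  \<open>S\<close> contains.\<close>

lemma Ck_on_cong:
  assumes "open S" "\<And>x. x \<in> S \<Longrightarrow> h x = h' x"
  shows "Ck_on k S h \<longleftrightarrow> Ck_on k S h'"
  using assms(2)
proof (induction k arbitrary: h h')
  case 0
  then show ?case by (simp cong: continuous_on_cong)
next
  case (Suc k)
  have "h' differentiable at x \<and> frechet_derivative h (at x) = frechet_derivative h' (at x)"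
    if "x \<in> S" "h differentiable at x" "\<And>x. x \<in> S \<Longrightarrow> h x = h' x" for x h h'
  proof -
    have "(h' has_derivative frechet_derivative h (at x)) (at x)"
      by (rule has_derivative_transform_within_open[OF has_derivative_frechet assms(1)])
        (use that in auto)
    then show ?thesis
      by (auto simp: differentiable_def intro: frechet_derivative_at)
  qed
  then have *: "(\<forall>x\<in>S. h differentiable at x) \<longleftrightarrow> (\<forall>x\<in>S. h' differentiable at x)"
    and **: "(\<forall>x\<in>S. h differentiable at x) \<Longrightarrow>
      \<forall>x\<in>S. frechet_derivative h (at x) = frechet_derivative h' (at x)"
    using Suc.prems by metis+
  show ?case
    using * ** Suc.IH[of "\<lambda>x. frechet_derivative h (at x) _" "\<lambda>x. frechet_derivative h' (at x) _"]
    by auto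
qed

text \<open>Allows a derivative given by a formula that is valid on \<open>S\<close> only.\<close>

lemma Ck_on_SucI:
  assumes "open S" "\<And>x. x \<in> S \<Longrightarrow> (h has_derivative h' x) (at x)"
    and "\<And>v. Ck_on k S (\<lambda>x. h' x v)"
  shows "Ck_on (Suc k) S h"
proof -
  have "Ck_on k S (\<lambda>x. frechet_derivative h (at x) v)" for v
    using assms(3)[of v] Ck_on_cong[OF assms(1), of "\<lambda>x. frechet_derivative h (at x) v" "\<lambda>x. h' x v" k]
      frechet_derivative_eqI[OF assms(2)] by blast
  then show ?thesis
    using assms(2) by (auto simp: differentiable_def)
qed

lemma Ck_on_Suc_has_derivative:
  "Ck_on (Suc k) S h \<Longrightarrow> x \<in> S \<Longrightarrow> (h has_derivative frechet_derivative h (at x)) (at x)"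
  by (simp add: has_derivative_frechet)

lemma Ck_on_SucD: "Ck_on (Suc k) S h \<Longrightarrow> Ck_on k S h"
proof (induction k arbitrary: h)
  case 0
  then show ?case
    by (auto intro!: continuous_at_imp_continuous_on differentiable_imp_continuous_within)
next
  case (Suc k)
  then show ?case by (auto simp del: Ck_on.simps(1))
qed

lemma Ck_on_subset: "Ck_on k S h \<Longrightarrow> T \<subseteq> S \<Longrightarrow> Ck_on k T h"
  by (induction k arbitrary: h) (auto intro: continuous_on_subset)

lemma Ck_on_Un:
  "open S \<Longrightarrow> open T \<Longrightarrow> Ck_on k S h \<Longrightarrow> Ck_on k T h \<Longrightarrow> Ck_on k (S \<union> T) h"
  by (induction k arbitrary: h) (auto intro: continuous_on_open_Un)

lemma Ck_on_const: "Ck_on k S (\<lambda>x. c)"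
  by (induction k arbitrary: c) (auto simp: frechet_derivative_const)

lemma Ck_on_bounded_linear:
  assumes "open S" "bounded_linear L"
  shows "Ck_on k S L"
proof (cases k)
  case 0
  then show ?thesis using assms(2) by (simp add: linear_continuous_on)
next
  case (Suc j)
  have "Ck_on (Suc j) S L"
    by (rule Ck_on_SucI[OF assms(1), where h' = "\<lambda>_. L"])
      (use assms(2) in \<open>auto intro: bounded_linear_imp_has_derivative Ck_on_const\<close>)
  then show ?thesis using Suc by simp
qed

lemma Ck_on_add:
  assumes "open S"
  shows "Ck_on k S h \<Longrightarrow> Ck_on k S h' \<Longrightarrow> Ck_on k S (\<lambda>x. h x + h' x)"
proof (induction k arbitrary: h h')
  case 0
  then show ?case by (auto intro: continuous_intros)
next
  case (Suc k)
  show ?case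
  proof (rule Ck_on_SucI[OF assms])
    show "((\<lambda>x. h x + h' x) has_derivative
        (\<lambda>v. frechet_derivative h (at x) v + frechet_derivative h' (at x) v)) (at x)" if "x \<in> S" for x
      by (rule has_derivative_add Ck_on_Suc_has_derivative Suc.prems that)+
  qed (use Suc in auto)
qed

lemma Ck_on_bilinear:
  assumes "open S" "bounded_bilinear B"
  shows "Ck_on k S h \<Longrightarrow> Ck_on k S h' \<Longrightarrow> Ck_on k S (\<lambda>x. B (h x) (h' x))"
proof (induction k arbitrary: h h')
  case 0
  then show ?case by (auto intro: bounded_bilinear.continuous_on[OF assms(2)])
next
  case (Suc k)
  show ?case
  proof (rule Ck_on_SucI[OF assms(1)])
    show "((\<lambda>x. B (h x) (h' x)) has_derivative
        (\<lambda>v. B (h x) (frechet_derivative h' (at x) v) + B (frechet_derivative h (at x) v) (h' x))) (at x)"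
      if "x \<in> S" for x
      by (rule bounded_bilinear.FDERIV[OF assms(2)] Ck_on_Suc_has_derivative Suc.prems that)+
    show "Ck_on k S (\<lambda>x. B (h x) (frechet_derivative h' (at x) v) +
        B (frechet_derivative h (at x) v) (h' x))" for v
      by (intro Ck_on_add[OF assms(1)] Suc.IH) (use Suc.prems Ck_on_SucD in auto)
  qed
qed

lemma Ck_on_sum:
  assumes "open S" "\<And>i. i \<in> I \<Longrightarrow> Ck_on k S (h i)"
  shows "Ck_on k S (\<lambda>x. \<Sum>i\<in>I. h i x)"
  using assms(2)
  by (induction I rule: infinite_finite_induct) (auto intro: Ck_on_const Ck_on_add[OF assms(1)])

lemma linear_basis_expansion:
  fixes L :: "'a::euclidean_space \<Rightarrow> 'b::real_vector"
  assumes "linear L"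
  shows "L v = (\<Sum>b\<in>Basis. (v \<bullet> b) *\<^sub>R L b)"
proof -
  have "L v = L (\<Sum>b\<in>Basis. (v \<bullet> b) *\<^sub>R b)" by (simp add: euclidean_representation)
  also have "\<dots> = (\<Sum>b\<in>Basis. (v \<bullet> b) *\<^sub>R L b)"
    by (simp add: linear_sum[OF assms] linear.scaleR[OF assms])
  finally show ?thesis .
qed

lemma Ck_on_compose:
  fixes T :: "'a::euclidean_space \<Rightarrow> 'b::euclidean_space" and h :: "'b \<Rightarrow> 'c::real_normed_vector"
  assumes "open S" "open S'" "T ` S \<subseteq> S'"
  shows "Ck_on k S' h \<Longrightarrow> Ck_on k S T \<Longrightarrow> Ck_on k S (h \<circ> T)"
proof (induction k arbitrary: h)
  case 0
  then show ?case
    using assms(3) continuous_on_compose[of S T h] continuous_on_subset[of S' h] by simp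
next
  case (Suc k)
  let ?T' = "\<lambda>x. frechet_derivative T (at x)" and ?h' = "\<lambda>y. frechet_derivative h (at y)"
  show ?case
  proof (rule Ck_on_SucI[OF assms(1)])
    fix x assume "x \<in> S"
    then have T: "(T has_derivative ?T' x) (at x)" and "T x \<in> S'"
      using Suc.prems assms(3) by (auto intro: Ck_on_Suc_has_derivative)
    then have h: "(h has_derivative ?h' (T x)) (at (T x))"
      using Suc.prems by (blast intro: Ck_on_Suc_has_derivative)
    \<comment> \<open>Base point and direction of \<open>?h'\<close> both move with
      \<open>x\<close>, but the induction hypothesis covers fixed directions only; the basis
      expansion separates the two into products.\<close>
    have "?h' (T x) (?T' x v) = (\<Sum>b\<in>Basis. (?T' x v \<bullet> b) *\<^sub>R ?h' (T x) b)" for v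
      by (rule linear_basis_expansion[OF has_derivative_linear[OF h]])
    then show "(h \<circ> T has_derivative
        (\<lambda>v. \<Sum>b\<in>Basis. (?T' x v \<bullet> b) *\<^sub>R (?h' \<circ> T) x b)) (at x)"
      using diff_chain_at[OF T h] by (simp add: o_def)
  next
    fix v
    have T: "Ck_on k S (\<lambda>x. ?T' x v)" "Ck_on k S T"
      using Suc.prems Ck_on_SucD by auto
    have h: "Ck_on k S ((\<lambda>y. ?h' y b) \<circ> T)" for b
      by (rule Suc.IH) (use Suc.prems T in auto)
    have i: "Ck_on k S (\<lambda>x. ?T' x v \<bullet> b)" for b
      by (rule Ck_on_bilinear[OF assms(1) bounded_bilinear_inner T(1) Ck_on_const])
    show "Ck_on k S (\<lambda>x. \<Sum>b\<in>Basis. (?T' x v \<bullet> b) *\<^sub>R (?h' \<circ> T) x b)"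
      using h by (intro Ck_on_sum Ck_on_bilinear[OF assms(1) bounded_bilinear_scaleR] assms(1) i)
        (simp add: o_def)
  qed
qed

section \<open>Closure properties of smooth maps\<close>

lemma smooth_on_cong:
  "open S \<Longrightarrow> (\<And>x. x \<in> S \<Longrightarrow> h x = h' x) \<Longrightarrow> smooth_on S h \<longleftrightarrow> smooth_on S h'"
  unfolding smooth_on_def using Ck_on_cong by blast

lemma smooth_on_subset: "smooth_on S h \<Longrightarrow> T \<subseteq> S \<Longrightarrow> smooth_on T h"
  unfolding smooth_on_def using Ck_on_subset by blast

lemma smooth_on_Un: "open S \<Longrightarrow> open T \<Longrightarrow> smooth_on S h \<Longrightarrow> smooth_on T h \<Longrightarrow> smooth_on (S \<union> T) h"
  unfolding smooth_on_def using Ck_on_Un by blast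

lemma smooth_on_const: "smooth_on S (\<lambda>x. c)"
  unfolding smooth_on_def using Ck_on_const by blast

lemma smooth_on_bounded_linear: "open S \<Longrightarrow> bounded_linear L \<Longrightarrow> smooth_on S L"
  unfolding smooth_on_def using Ck_on_bounded_linear by blast

lemma smooth_on_add:
  "open S \<Longrightarrow> smooth_on S h \<Longrightarrow> smooth_on S h' \<Longrightarrow> smooth_on S (\<lambda>x. h x + h' x)"
  unfolding smooth_on_def using Ck_on_add by blast

lemma smooth_on_bilinear:
  "open S \<Longrightarrow> bounded_bilinear B \<Longrightarrow> smooth_on S h \<Longrightarrow> smooth_on S h' \<Longrightarrow>
    smooth_on S (\<lambda>x. B (h x) (h' x))"
  unfolding smooth_on_def using Ck_on_bilinear by blast

lemma smooth_on_sum: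
  "open S \<Longrightarrow> (\<And>i. i \<in> I \<Longrightarrow> smooth_on S (h i)) \<Longrightarrow> smooth_on S (\<lambda>x. \<Sum>i\<in>I. h i x)"
  unfolding smooth_on_def by (simp add: Ck_on_sum)

lemma smooth_on_compose:
  "open S \<Longrightarrow> open S' \<Longrightarrow> T ` S \<subseteq> S' \<Longrightarrow> smooth_on S' h \<Longrightarrow> smooth_on S T \<Longrightarrow> smooth_on S (h \<circ> T)"
  unfolding smooth_on_def using Ck_on_compose by blast

lemma smooth_on_has_derivative:
  "smooth_on S h \<Longrightarrow> x \<in> S \<Longrightarrow> (h has_derivative frechet_derivative h (at x)) (at x)"
  unfolding smooth_on_def by (rule Ck_on_Suc_has_derivative[of 0]) auto

lemma smooth_on_deriv: "smooth_on S h \<Longrightarrow> smooth_on S (\<lambda>x. frechet_derivative h (at x) v)"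
  unfolding smooth_on_def by (metis Ck_on.simps(2))

text \<open>\<open>smooth_on\<close> controls derivatives in fixed directions; expanding the moving
  direction \<open>W\<close> in the basis reduces to these.\<close>

lemma smooth_on_deriv_apply:
  fixes h :: "'a::euclidean_space \<Rightarrow> 'b::real_normed_vector"
  assumes "open S" "smooth_on S h" "smooth_on S W"
  shows "smooth_on S (\<lambda>x. frechet_derivative h (at x) (W x))"
proof -
  have i: "smooth_on S (\<lambda>x. W x \<bullet> b)" for b
    by (rule smooth_on_bilinear[OF assms(1) bounded_bilinear_inner assms(3) smooth_on_const])
  have "smooth_on S (\<lambda>x. \<Sum>b\<in>Basis. (W x \<bullet> b) *\<^sub>R frechet_derivative h (at x) b)"
    by (intro smooth_on_sum smooth_on_bilinear[OF assms(1) bounded_bilinear_scaleR] assms(1) i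
        smooth_on_deriv assms(2))
  moreover have "frechet_derivative h (at x) (W x) =
      (\<Sum>b\<in>Basis. (W x \<bullet> b) *\<^sub>R frechet_derivative h (at x) b)" if "x \<in> S" for x
    by (rule linear_basis_expansion[OF has_derivative_linear[OF smooth_on_has_derivative[OF assms(2) that]]])
  ultimately show ?thesis
    by (subst smooth_on_cong[OF assms(1)]) auto
qed

lemma smooth_on_inverse: "smooth_on {0<..} (inverse :: real \<Rightarrow> real)"
proof -
  have "Ck_on k {0<..} (inverse :: real \<Rightarrow> real)" for k
  proof (induction k)
    case 0
    then show ?case by (auto intro!: continuous_intros)
  next
    case (Suc k)
    show ?case
    proof (rule Ck_on_SucI)
      \<comment> \<open>Written through \<open>inverse\<close> itself, the derivative stays within
        reach of the induction hypothesis.\<close>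
      show "(inverse has_derivative (\<lambda>v. inverse x * inverse x * - v)) (at x)"
        if "x \<in> {0<..}" for x :: real
        using that by (auto intro!: derivative_eq_intros simp: algebra_simps)
      show "Ck_on k {0<..} (\<lambda>x::real. inverse x * inverse x * - v)" for v
        by (intro Ck_on_bilinear[OF _ bounded_bilinear_mult] Suc Ck_on_const) auto
    qed auto
  qed
  then show ?thesis by (simp add: smooth_on_def)
qed

subsection \<open>Bump functions\<close>

text \<open>The derivative of a function of this family is again in the family.\<close>

definition exp_flat :: "real poly \<Rightarrow> real \<Rightarrow> real" where
  "exp_flat q t = (if t > 0 then poly q (1 / t) * exp (- (1 / t)) else 0)"

lemma tendsto_poly_exp_0: "((\<lambda>s::real. poly q s * exp (- s)) \<longlongrightarrow> 0) at_top"
proof -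
  have "((\<lambda>s. \<Sum>i\<le>degree q. coeff q i * (s ^ i / exp s)) \<longlongrightarrow> (\<Sum>i\<le>degree q. coeff q i * 0)) at_top"
    by (intro tendsto_intros tendsto_power_div_exp_0)
  then show ?thesis
    by (simp add: poly_altdef sum_distrib_right exp_minus divide_inverse mult.assoc)
qed

text \<open>With s = 1 / t one has d/dt = - s^2 d/ds, so q exp(-s) becomes s^2 (q - q') exp(-s): the
  polynomial in the statement.\<close>

lemma exp_flat_has_derivative:
  "(exp_flat q has_real_derivative exp_flat ([:0, 0, 1:] * (q - pderiv q)) t) (at t)"
proof -
  consider "t > 0" | "t < 0" | "t = 0" by linarith
  then show ?thesis
  proof cases
    case 1
    have "((\<lambda>t. poly q (1 / t) * exp (- (1 / t))) has_real_derivative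
        poly (pderiv q) (1 / t) * (- 1 / t\<^sup>2) * exp (- (1 / t))
        + exp (- (1 / t)) * (1 / t\<^sup>2) * poly q (1 / t)) (at t)"
      using 1 by (intro DERIV_mult DERIV_chain2[OF poly_DERIV])
        (auto intro!: derivative_eq_intros simp: power2_eq_square)
    moreover have "poly (pderiv q) (1 / t) * (- 1 / t\<^sup>2) * exp (- (1 / t))
        + exp (- (1 / t)) * (1 / t\<^sup>2) * poly q (1 / t) = exp_flat ([:0, 0, 1:] * (q - pderiv q)) t"
      using 1 by (simp add: exp_flat_def power2_eq_square algebra_simps)
    ultimately have "((\<lambda>t. poly q (1 / t) * exp (- (1 / t))) has_real_derivative
        exp_flat ([:0, 0, 1:] * (q - pderiv q)) t) (at t)"
      by simp
    then show ?thesis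
      by (rule has_field_derivative_transform_within_open[where S = "{0<..}"])
        (use 1 in \<open>auto simp: exp_flat_def\<close>)
  next
    case 2
    have "((\<lambda>t. 0) has_real_derivative exp_flat ([:0, 0, 1:] * (q - pderiv q)) t) (at t)"
      using 2 by (simp add: exp_flat_def)
    then show ?thesis
      by (rule has_field_derivative_transform_within_open[where S = "{..<0}"])
        (use 2 in \<open>auto simp: exp_flat_def\<close>)
  next
    case 3
    \<comment> \<open>The difference quotient at 0 carries one more factor 1 / t, hence the extra
      factor \<open>[:0, 1:]\<close>.\<close>
    have "((\<lambda>t. poly ([:0, 1:] * q) (inverse t) * exp (- inverse t)) \<longlongrightarrow> 0) (at_right 0)"
      by (rule filterlim_compose[OF tendsto_poly_exp_0 filterlim_inverse_at_top_right])
    then have "((\<lambda>t. exp_flat q t / t) \<longlongrightarrow> 0) (at_right 0)"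
      by (rule Lim_transform_eventually)
        (auto simp: eventually_at_filter exp_flat_def field_simps)
    moreover have "((\<lambda>t. exp_flat q t / t) \<longlongrightarrow> 0) (at_left 0)"
      by (rule Lim_transform_eventually[OF tendsto_const])
        (auto simp: eventually_at_filter exp_flat_def)
    ultimately have "((\<lambda>t. exp_flat q t / t) \<longlongrightarrow> 0) (at 0)"
      by (simp add: filterlim_split_at)
    then show ?thesis
      using 3 by (simp add: has_field_derivative_iff exp_flat_def)
  qed
qed

lemma smooth_on_exp_flat: "smooth_on UNIV (exp_flat q)"
proof -
  have "Ck_on k UNIV (exp_flat q)" for k
  proof (induction k arbitrary: q)
    case 0
    show ?case
      by (auto intro!: continuous_at_imp_continuous_on DERIV_isCont exp_flat_has_derivative)
  next
    case (Suc k)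
    show ?case
    proof (rule Ck_on_SucI)
      show "(exp_flat q has_derivative (*) (exp_flat ([:0, 0, 1:] * (q - pderiv q)) t)) (at t)" for t
        using exp_flat_has_derivative by (simp add: has_field_derivative_def)
      show "Ck_on k UNIV (\<lambda>t. exp_flat ([:0, 0, 1:] * (q - pderiv q)) t * v)" for v
        by (rule Ck_on_bilinear[OF _ bounded_bilinear_mult Suc Ck_on_const]) simp
    qed auto
  qed
  then show ?thesis by (simp add: smooth_on_def)
qed

text \<open>The quotient a / d, where \<open>a\<close> is positive exactly inside radius 2 r and
  \<open>d - a\<close> exactly outside radius r, so that the denominator never vanishes.\<close>

lemma bump_function_exists:
  fixes p :: "'a::euclidean_space"
  assumes "r > 0"
  obtains b :: "'a \<Rightarrow> real" where "smooth_on UNIV b" "\<And>x. x \<in> ball p r \<Longrightarrow> b x = 1"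
    "\<And>x. x \<notin> cball p (2 * r) \<Longrightarrow> b x = 0"
proof -
  \<comment> \<open>The squared distance, because the distance itself is not smooth at
    \<open>p\<close>.\<close>
  define N where "N x = (x - p) \<bullet> (x - p)" for x
  define u where "u = exp_flat 1"
  define a where "a x = u (4 * r\<^sup>2 - N x)" for x
  define d where "d x = a x + u (N x - r\<^sup>2)" for x
  have N: "N x = (dist p x)\<^sup>2" for x
    unfolding N_def by (metis dist_commute dist_norm power2_norm_eq_inner)
  have smN: "smooth_on UNIV N"
    unfolding N_def
    by (intro smooth_on_bilinear[OF _ bounded_bilinear_inner])
      (simp_all add: diff_conv_add_uminus smooth_on_add smooth_on_const
        smooth_on_bounded_linear bounded_linear_ident del: add_uminus_conv_diff)
  have smu: "smooth_on UNIV (\<lambda>x. u (k + m * N x))" for k m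
  proof -
    have "smooth_on UNIV (\<lambda>x. k + m * N x)"
      by (intro smooth_on_add smooth_on_const smooth_on_bilinear[OF _ bounded_bilinear_mult] smN) auto
    then have "smooth_on UNIV (u \<circ> (\<lambda>x. k + m * N x))"
      unfolding u_def by (intro smooth_on_compose[where S' = UNIV] smooth_on_exp_flat) auto
    then show ?thesis by (simp add: o_def)
  qed
  have sma: "smooth_on UNIV a" and smd: "smooth_on UNIV d"
    using smu[of "4 * r\<^sup>2" "-1"] smu[of "- r\<^sup>2" 1]
    by (auto simp: a_def[abs_def] d_def[abs_def] algebra_simps intro: smooth_on_add)
  have u: "u t > 0 \<longleftrightarrow> t > 0" "u t \<ge> 0" "u t = 0 \<longleftrightarrow> t \<le> 0" for t
    by (auto simp: u_def exp_flat_def)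
  have "d x > 0" for x
  proof (cases "N x < 4 * r\<^sup>2")
    case True
    then show ?thesis by (simp add: d_def a_def u add_pos_nonneg)
  next
    case False
    moreover have "r\<^sup>2 > 0" using assms by simp
    ultimately have "N x > r\<^sup>2" by linarith
    then show ?thesis by (simp add: d_def a_def u add_nonneg_pos)
  qed
  then have "smooth_on UNIV (inverse \<circ> d)"
    by (intro smooth_on_compose[where S' = "{0<..}"] smooth_on_inverse smd) auto
  then have "smooth_on UNIV (\<lambda>x. a x * (inverse \<circ> d) x)"
    by (rule smooth_on_bilinear[OF open_UNIV bounded_bilinear_mult sma])
  moreover have "a x * (inverse \<circ> d) x = 1" if "x \<in> ball p r" for x
  proof -
    have "N x \<le> r\<^sup>2" using that by (auto simp: N intro: power_mono)
    then have "d x = a x" by (simp add: d_def u)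
    then show ?thesis using \<open>d x > 0\<close> by simp
  qed
  moreover have "a x * (inverse \<circ> d) x = 0" if "x \<notin> cball p (2 * r)" for x
  proof -
    have "(2 * r)\<^sup>2 \<le> N x" using that assms unfolding N by (intro power_mono) auto
    then show ?thesis by (simp add: a_def u power_mult_distrib)
  qed
  ultimately show ?thesis using that[of "\<lambda>x. a x * (inverse \<circ> d) x"] by blast
qed

subsection \<open>Second derivatives and traces\<close>

text \<open>Two mean value steps: along \<open>v\<close> for the increment \<phi> in direction
  \<open>w\<close>, then along \<open>w\<close> for the derivative so obtained.\<close>

lemma second_difference_mean_value:
  fixes h :: "'a::euclidean_space \<Rightarrow> real"
  assumes "smooth_on S h" "t > 0" "cball x (t * (norm v + norm w)) \<subseteq> S"
  obtains y where "y \<in> cball x (t * (norm v + norm w))"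
    "h (x + t *\<^sub>R v + t *\<^sub>R w) - h (x + t *\<^sub>R v) - h (x + t *\<^sub>R w) + h x
      = t\<^sup>2 * frechet_derivative (\<lambda>y. frechet_derivative h (at y) v) (at y) w"
proof -
  let ?h = "\<lambda>y. frechet_derivative h (at y)"
  let ?hv = "\<lambda>y. frechet_derivative h (at y) v"
  have mem: "x + r *\<^sub>R v + q *\<^sub>R w \<in> cball x (t * (norm v + norm w))"
    if "0 \<le> r" "r \<le> t" "0 \<le> q" "q \<le> t" for r q
  proof -
    have "norm (r *\<^sub>R v + q *\<^sub>R w) \<le> r * norm v + q * norm w"
      using norm_triangle_ineq[of "r *\<^sub>R v" "q *\<^sub>R w"] that by simp
    also have "\<dots> \<le> t * norm v + t * norm w"
      using that by (intro add_mono mult_right_mono) auto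
    finally show ?thesis by (simp add: dist_norm algebra_simps norm_minus_commute)
  qed
  define \<phi> where "\<phi> r = h (x + r *\<^sub>R v + t *\<^sub>R w) - h (x + r *\<^sub>R v)" for r
  have D: "((\<lambda>r. h (x + r *\<^sub>R v + q *\<^sub>R w)) has_real_derivative ?hv (x + r *\<^sub>R v + q *\<^sub>R w)) (at r)"
    if "0 \<le> r" "r \<le> t" "0 \<le> q" "q \<le> t" for r q
  proof -
    have h: "(h has_derivative ?h (x + r *\<^sub>R v + q *\<^sub>R w)) (at (x + r *\<^sub>R v + q *\<^sub>R w))"
      using smooth_on_has_derivative[OF assms(1)] mem[OF that] assms(3) by auto
    have "((\<lambda>r. x + r *\<^sub>R v + q *\<^sub>R w) has_derivative (\<lambda>a. a *\<^sub>R v)) (at r)"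
      by (auto intro!: derivative_eq_intros)
    from diff_chain_at[OF this h] show ?thesis
      using linear.scaleR[OF has_derivative_linear[OF h]]
      by (simp add: has_field_derivative_def o_def mult_commute_abs)
  qed
  have D\<phi>: "(\<phi> has_real_derivative
      ?hv (x + r *\<^sub>R v + t *\<^sub>R w) - ?hv (x + r *\<^sub>R v)) (at r)" if "0 \<le> r" "r \<le> t" for r
    unfolding \<phi>_def using D[of r t] D[of r 0] that assms(2) by (auto intro: DERIV_diff)
  obtain \<theta> where \<theta>: "0 < \<theta>" "\<theta> < t"
    "\<phi> t - \<phi> 0 = (t - 0) * (?hv (x + \<theta> *\<^sub>R v + t *\<^sub>R w) - ?hv (x + \<theta> *\<^sub>R v))"
    using MVT2[OF assms(2), of \<phi>, OF D\<phi>] by blast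
  have D2: "((\<lambda>q. ?hv (x + \<theta> *\<^sub>R v + q *\<^sub>R w)) has_real_derivative
      frechet_derivative ?hv (at (x + \<theta> *\<^sub>R v + q *\<^sub>R w)) w) (at q)" if "0 \<le> q" "q \<le> t" for q
  proof -
    have h: "(?hv has_derivative frechet_derivative ?hv (at (x + \<theta> *\<^sub>R v + q *\<^sub>R w)))
        (at (x + \<theta> *\<^sub>R v + q *\<^sub>R w))"
      using smooth_on_has_derivative[OF smooth_on_deriv[OF assms(1)]] mem[of \<theta> q] that \<theta> assms(3)
      by auto
    have "((\<lambda>q. x + \<theta> *\<^sub>R v + q *\<^sub>R w) has_derivative (\<lambda>a. a *\<^sub>R w)) (at q)"
      by (auto intro!: derivative_eq_intros)
    from diff_chain_at[OF this h] show ?thesis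
      using linear.scaleR[OF has_derivative_linear[OF h]]
      by (simp add: has_field_derivative_def o_def mult_commute_abs)
  qed
  obtain \<theta>' where \<theta>': "0 < \<theta>'" "\<theta>' < t"
    "?hv (x + \<theta> *\<^sub>R v + t *\<^sub>R w) - ?hv (x + \<theta> *\<^sub>R v + 0 *\<^sub>R w)
      = (t - 0) * frechet_derivative ?hv (at (x + \<theta> *\<^sub>R v + \<theta>' *\<^sub>R w)) w"
    using MVT2[OF assms(2), of "\<lambda>q. ?hv (x + \<theta> *\<^sub>R v + q *\<^sub>R w)", OF D2] by blast
  show ?thesis
  proof (rule that)
    show "x + \<theta> *\<^sub>R v + \<theta>' *\<^sub>R w \<in> cball x (t * (norm v + norm w))"
      using mem \<theta> \<theta>' by auto
    show "h (x + t *\<^sub>R v + t *\<^sub>R w) - h (x + t *\<^sub>R v) - h (x + t *\<^sub>R w) + h x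
      = t\<^sup>2 * frechet_derivative ?hv (at (x + \<theta> *\<^sub>R v + \<theta>' *\<^sub>R w)) w"
      using \<theta>(3) \<theta>'(3) by (simp add: \<phi>_def power2_eq_square)
  qed
qed

text \<open>The second difference is symmetric in \<open>v\<close> and \<open>w\<close>, so the two
  mixed derivatives share a value at points \<open>y\<close> and \<open>z\<close> arbitrarily close
  to \<open>x\<close>; continuity does the rest.\<close>

lemma second_derivative_symmetric:
  fixes h :: "'a::euclidean_space \<Rightarrow> real"
  assumes "open S" "smooth_on S h" "x \<in> S"
  shows "frechet_derivative (\<lambda>y. frechet_derivative h (at y) v) (at x) w
       = frechet_derivative (\<lambda>y. frechet_derivative h (at y) w) (at x) v"
proof (rule ccontr)
  let ?D = "\<lambda>v w y. frechet_derivative (\<lambda>y. frechet_derivative h (at y) v) (at y) w"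
  assume ne: "?D v w x \<noteq> ?D w v x"
  define e where "e = \<bar>?D v w x - ?D w v x\<bar> / 2"
  have "e > 0" using ne by (simp add: e_def)
  have cont: "isCont (?D v w) x" for v w
    using smooth_on_has_derivative[OF smooth_on_deriv[OF smooth_on_deriv[OF assms(2)]] assms(3)]
    by (rule has_derivative_continuous)
  obtain d1 where d1: "d1 > 0" "\<And>y. dist y x < d1 \<Longrightarrow> dist (?D v w y) (?D v w x) < e"
    using cont[of v w] \<open>e > 0\<close> unfolding continuous_at_eps_delta by (metis dist_commute)
  obtain d2 where d2: "d2 > 0" "\<And>y. dist y x < d2 \<Longrightarrow> dist (?D w v y) (?D w v x) < e"
    using cont[of w v] \<open>e > 0\<close> unfolding continuous_at_eps_delta by (metis dist_commute)
  obtain d3 where d3: "d3 > 0" "cball x d3 \<subseteq> S"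
    using assms open_contains_cball by blast
  \<comment> \<open>The halves give strict inequalities, since \<open>y\<close> and \<open>z\<close>
    are only known to lie in a closed ball.\<close>
  define d where "d = min d3 (min (d1 / 2) (d2 / 2))"
  have d: "d > 0" "d < d1" "d < d2" "d \<le> d3" using d1 d2 d3 by (auto simp: d_def)
  define t where "t = d / (norm v + norm w + 1)"
  have np: "norm v + norm w + 1 > 0" by (simp add: add_nonneg_pos)
  have t: "t > 0" using d np by (simp add: t_def)
  have le: "t * (norm v + norm w) \<le> d"
  proof -
    have "t * (norm v + norm w) \<le> t * (norm v + norm w + 1)" using t by (intro mult_left_mono) auto
    also have "\<dots> = d" using np by (simp add: t_def)
    finally show ?thesis .
  qed
  have sub: "cball x (t * (norm v + norm w)) \<subseteq> S" using le d d3 by (auto intro: subset_trans)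
  have sub': "cball x (t * (norm w + norm v)) \<subseteq> S" using sub by (simp add: add.commute)
  obtain y where y: "y \<in> cball x (t * (norm v + norm w))"
    "h (x + t *\<^sub>R v + t *\<^sub>R w) - h (x + t *\<^sub>R v) - h (x + t *\<^sub>R w) + h x = t\<^sup>2 * ?D v w y"
    using second_difference_mean_value[OF assms(2) t sub] by blast
  obtain z where z: "z \<in> cball x (t * (norm w + norm v))"
    "h (x + t *\<^sub>R w + t *\<^sub>R v) - h (x + t *\<^sub>R w) - h (x + t *\<^sub>R v) + h x = t\<^sup>2 * ?D w v z"
    using second_difference_mean_value[OF assms(2) t sub'] by blast
  have "t\<^sup>2 * ?D v w y = t\<^sup>2 * ?D w v z"
    using y(2) z(2) by (simp add: algebra_simps)
  then have eq: "?D v w y = ?D w v z" using t by simp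
  have "dist y x < d1" "dist z x < d2"
    using y(1) z(1) le d by (auto simp: dist_commute add.commute)
  then have "dist (?D v w y) (?D v w x) < e" "dist (?D w v z) (?D w v x) < e"
    by (auto intro: d1 d2)
  then show False using eq by (auto simp: dist_real_def e_def abs_if split: if_splits)
qed

lemma frechet_derivative_apply:
  fixes h :: "'a::euclidean_space \<Rightarrow> 'b::real_normed_vector"
  assumes "open S" "smooth_on S h" "x \<in> S" "(W has_derivative W') (at x)"
  shows "((\<lambda>y. frechet_derivative h (at y) (W y)) has_derivative
    (\<lambda>v. frechet_derivative (\<lambda>y. frechet_derivative h (at y) (W x)) (at x) v
       + frechet_derivative h (at x) (W' v))) (at x)"
proof -
  let ?h = "\<lambda>y. frechet_derivative h (at y)"
  let ?hh = "\<lambda>b. frechet_derivative (\<lambda>y. ?h y b) (at x)"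
  have expand: "?h y v = (\<Sum>b\<in>Basis. (v \<bullet> b) *\<^sub>R ?h y b)" if "y \<in> S" for y v
    by (rule linear_basis_expansion[OF has_derivative_linear[OF smooth_on_has_derivative[OF assms(2) that]]])
  have *: "((\<lambda>y. ?h y (W y)) has_derivative
      (\<lambda>v. \<Sum>b\<in>Basis. (W x \<bullet> b) *\<^sub>R ?hh b v + (W' v \<bullet> b) *\<^sub>R ?h x b)) (at x)"
    if "(W has_derivative W') (at x)" for W W'
  proof -
    have "((\<lambda>y. \<Sum>b\<in>Basis. (W y \<bullet> b) *\<^sub>R ?h y b) has_derivative
        (\<lambda>v. \<Sum>b\<in>Basis. (W x \<bullet> b) *\<^sub>R ?hh b v + (W' v \<bullet> b) *\<^sub>R ?h x b)) (at x)"
      by (intro has_derivative_sum has_derivative_scaleR has_derivative_inner_left that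
          smooth_on_has_derivative[OF smooth_on_deriv[OF assms(2)] assms(3)])
    then show ?thesis
      by (rule has_derivative_transform_within_open[OF _ assms(1,3)]) (simp add: expand[symmetric])
  qed
  have "?hh (W x) v = (\<Sum>b\<in>Basis. (W x \<bullet> b) *\<^sub>R ?hh b v)" for v
    using frechet_derivative_eqI[OF *[OF has_derivative_const], of "W x" v] by simp
  then show ?thesis
    using *[OF assms(4)] expand[OF assms(3), symmetric] by (simp add: sum.distrib)
qed

lemma trace_matrix:
  fixes L :: "real ^ 'd \<Rightarrow> real ^ 'd"
  shows "trace (matrix L) = (\<Sum>i\<in>UNIV. L (axis i 1) $ i)"
  by (simp add: trace_def matrix_def)

lemma trace_matrix_compose_commute:
  fixes L M :: "real ^ 'd \<Rightarrow> real ^ 'd"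
  assumes "linear L" "linear M"
  shows "trace (matrix (L \<circ> M)) = trace (matrix (M \<circ> L))"
  using assms by (metis matrix_compose trace_mul_sym)

lemma trace_matrix_rank_one:
  fixes v :: "real ^ 'd"
  assumes "linear \<alpha>"
  shows "trace (matrix (\<lambda>z. \<alpha> z *\<^sub>R v)) = \<alpha> v"
proof -
  have "\<alpha> v = \<alpha> (\<Sum>i\<in>UNIV. v $ i *\<^sub>R axis i 1)"
    using basis_expansion[of v] by (simp add: scalar_mult_eq_scaleR)
  also have "\<dots> = (\<Sum>i\<in>UNIV. v $ i * \<alpha> (axis i 1))"
    by (simp add: linear_sum[OF assms] linear.scaleR[OF assms])
  finally show ?thesis by (simp add: trace_matrix mult.commute)
qed

lemma has_derivative_vec_nth:
  "(f has_derivative f') F \<Longrightarrow> ((\<lambda>x. f x $ i) has_derivative (\<lambda>v. f' v $ i)) F"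
  by (rule bounded_linear.has_derivative[OF bounded_linear_vec_nth])

subsection \<open>Charts\<close>

locale smooth_manifold =
  fixes A :: "('m::{t2_space,second_countable_topology}, 'd::finite) chart set"
  assumes atlas: "smooth_atlas A"
begin

definition transition :: "('m, 'd) chart \<Rightarrow> ('m, 'd) chart \<Rightarrow> real ^ 'd \<Rightarrow> real ^ 'd" where
  "transition c c' = snd c' \<circ> chart_inv c"

lemma chart_at_in: "chart_at A p \<in> A" "p \<in> fst (chart_at A p)"
  using chart_at_props[OF atlas] by auto

lemma chart_homeomorphism:
  "c \<in> A \<Longrightarrow> homeomorphism (fst c) (snd c ` fst c) (snd c) (chart_inv c)"
  using atlas by (simp add: smooth_atlas_def)

lemma open_chart_domain: "c \<in> A \<Longrightarrow> open (fst c)"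
  using atlas by (simp add: smooth_atlas_def)

lemma open_chart_image: "c \<in> A \<Longrightarrow> open (snd c ` fst c)"
  using atlas by (simp add: smooth_atlas_def)

lemma chart_inv_chart [simp]: "c \<in> A \<Longrightarrow> q \<in> fst c \<Longrightarrow> chart_inv c (snd c q) = q"
  using chart_homeomorphism[of c] by (simp add: homeomorphism_def)

lemma open_chart_subimage:
  assumes "c \<in> A" "open U"
  shows "open (snd c ` (fst c \<inter> U))"
proof -
  have "snd c ` (fst c \<inter> U) = snd c ` fst c \<inter> chart_inv c -` U"
    using assms(1) by auto
  moreover have "continuous_on (snd c ` fst c) (chart_inv c)"
    using chart_homeomorphism[OF assms(1)] by (simp add: homeomorphism_def)
  ultimately show ?thesis
    using continuous_on_open_vimage[OF open_chart_image[OF assms(1)]] assms(2)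
    by (metis Int_commute)
qed

lemma transition_smooth:
  "c \<in> A \<Longrightarrow> c' \<in> A \<Longrightarrow> smooth_on (snd c ` (fst c \<inter> fst c')) (transition c c')"
  using atlas by (simp add: smooth_atlas_def transition_def)

lemma transition_chart [simp]: "c \<in> A \<Longrightarrow> q \<in> fst c \<Longrightarrow> transition c c' (snd c q) = snd c' q"
  by (simp add: transition_def)

lemma transition_has_derivative:
  assumes "c \<in> A" "c' \<in> A" "q \<in> fst c" "q \<in> fst c'"
  shows "(transition c c' has_derivative frechet_derivative (transition c c') (at (snd c q)))
    (at (snd c q))"
  using smooth_on_has_derivative[OF transition_smooth[OF assms(1,2)]] assms by blast

lemma chart_change_has_derivative:
  assumes "c \<in> A" "c' \<in> A" "q \<in> fst c" "q \<in> fst c'"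
    and "(h \<circ> chart_inv c' has_derivative H) (at (snd c' q))"
  shows "(h \<circ> chart_inv c has_derivative
    (\<lambda>v. H (frechet_derivative (transition c c') (at (snd c q)) v))) (at (snd c q))"
proof -
  have "((h \<circ> chart_inv c') \<circ> transition c c' has_derivative
      H \<circ> frechet_derivative (transition c c') (at (snd c q))) (at (snd c q))"
    using assms by (intro diff_chain_at transition_has_derivative) simp_all
  then have "((h \<circ> chart_inv c') \<circ> transition c c' has_derivative
      (\<lambda>v. H (frechet_derivative (transition c c') (at (snd c q)) v))) (at (snd c q))"
    by (simp add: o_def)
  then show ?thesis
    by (rule has_derivative_transform_within_open[OF _
          open_chart_subimage[OF assms(1) open_chart_domain[OF assms(2)]]])
      (use assms in auto)
qed

lemma dchart_eq: "dchart A c q = frechet_derivative (transition (chart_at A q) c) (at (snd (chart_at A q) q))"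
  by (simp add: dchart_def transition_def)

lemma linear_dchart: "c \<in> A \<Longrightarrow> q \<in> fst c \<Longrightarrow> linear (dchart A c q)"
  unfolding dchart_eq
  by (rule has_derivative_linear[OF transition_has_derivative]) (auto simp: chart_at_in)

lemma dchart_change:
  assumes "c \<in> A" "c' \<in> A" "q \<in> fst c" "q \<in> fst c'"
  shows "dchart A c' q v = frechet_derivative (transition c c') (at (snd c q)) (dchart A c q v)"
proof -
  have "(snd c' \<circ> chart_inv c has_derivative frechet_derivative (transition c c') (at (snd c q)))
      (at (snd c q))"
    using transition_has_derivative[OF assms] by (simp add: transition_def)
  from chart_change_has_derivative[OF chart_at_in(1) assms(1) chart_at_in(2) assms(3) this]
  show ?thesis
    by (simp add: dchart_def transition_def frechet_derivative_eqI)
qed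

text \<open>The inverse of \<open>dchart A c q\<close>, obtained from the reverse transition map,
  from \<open>c\<close> to the chart chosen at \<open>q\<close>.\<close>

definition dchart_inv :: "('m, 'd) chart \<Rightarrow> 'm \<Rightarrow> real ^ 'd \<Rightarrow> real ^ 'd" where
  "dchart_inv c q = frechet_derivative (transition c (chart_at A q)) (at (snd c q))"

lemma linear_dchart_inv: "c \<in> A \<Longrightarrow> q \<in> fst c \<Longrightarrow> linear (dchart_inv c q)"
  unfolding dchart_inv_def
  by (rule has_derivative_linear[OF transition_has_derivative]) (auto simp: chart_at_in)

lemma dchart_inv_dchart: "c \<in> A \<Longrightarrow> q \<in> fst c \<Longrightarrow> dchart_inv c q (dchart A c q v) = v"
  using dchart_change[of c "chart_at A q" q v]
  by (simp add: dchart_inv_def chart_at_in dchart_chart_at[OF atlas])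

lemma dchart_dchart_inv:
  assumes "c \<in> A" "q \<in> fst c"
  shows "dchart A c q (dchart_inv c q v) = v"
proof -
  let ?d = "chart_at A q"
  have "(snd c \<circ> chart_inv c has_derivative (\<lambda>v. dchart A c q (dchart_inv c q v))) (at (snd c q))"
    unfolding dchart_inv_def dchart_def
    by (rule chart_change_has_derivative)
      (use assms chart_at_in transition_has_derivative[of ?d c q] in \<open>auto simp: transition_def simp del: o_apply\<close>)
  moreover have "(snd c \<circ> chart_inv c has_derivative (\<lambda>v. v)) (at (snd c q))"
    by (rule has_derivative_transform_within_open[OF has_derivative_ident open_chart_image[OF assms(1)]])
      (use assms in auto)
  ultimately show ?thesis
    using has_derivative_unique by metis
qed

subsection \<open>Smooth functions and vector fields\<close>

lemma smooth_funD: "smooth_fun A h \<Longrightarrow> c \<in> A \<Longrightarrow> smooth_on (snd c ` fst c) (h \<circ> chart_inv c)"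
  by (simp add: smooth_fun_def)

lemma smooth_vfD: "smooth_vf A X \<Longrightarrow> c \<in> A \<Longrightarrow> smooth_on (snd c ` fst c) (vf_rep A c X)"
  by (simp add: smooth_vf_def)

lemma vf_rep_chart: "c \<in> A \<Longrightarrow> q \<in> fst c \<Longrightarrow> vf_rep A c X (snd c q) = dchart A c q (X q)"
  by (simp add: vf_rep_def)

lemma smooth_funI:
  assumes "\<And>c. c \<in> A \<Longrightarrow> smooth_on (snd c ` fst c) (H c)"
    "\<And>c q. c \<in> A \<Longrightarrow> q \<in> fst c \<Longrightarrow> H c (snd c q) = h q"
  shows "smooth_fun A h"
  unfolding smooth_fun_def
proof
  fix c assume c: "c \<in> A"
  show "smooth_on (snd c ` fst c) (h \<circ> chart_inv c)"
    by (subst smooth_on_cong[OF open_chart_image[OF c], where h' = "H c"])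
      (use c in \<open>auto simp: assms\<close>)
qed

lemma smooth_vfI:
  assumes "\<And>c. c \<in> A \<Longrightarrow> smooth_on (snd c ` fst c) (H c)"
    "\<And>c q. c \<in> A \<Longrightarrow> q \<in> fst c \<Longrightarrow> H c (snd c q) = dchart A c q (X q)"
  shows "smooth_vf A X"
  unfolding smooth_vf_def
proof
  fix c assume c: "c \<in> A"
  show "smooth_on (snd c ` fst c) (vf_rep A c X)"
    by (subst smooth_on_cong[OF open_chart_image[OF c], where h' = "H c"])
      (use c in \<open>auto simp: assms vf_rep_chart\<close>)
qed

lemma smooth_fun_const: "smooth_fun A (\<lambda>q. k)"
  by (rule smooth_funI[where H = "\<lambda>c y. k"]) (auto intro: smooth_on_const)

lemma smooth_fun_add: "smooth_fun A h \<Longrightarrow> smooth_fun A k \<Longrightarrow> smooth_fun A (\<lambda>q. h q + k q)"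
  by (rule smooth_funI[where H = "\<lambda>c y. (h \<circ> chart_inv c) y + (k \<circ> chart_inv c) y"])
    (simp_all add: smooth_on_add open_chart_image smooth_funD del: o_apply, simp)

lemma smooth_fun_mult: "smooth_fun A h \<Longrightarrow> smooth_fun A k \<Longrightarrow> smooth_fun A (\<lambda>q. h q * k q)"
  by (rule smooth_funI[where H = "\<lambda>c y. (h \<circ> chart_inv c) y * (k \<circ> chart_inv c) y"])
    (simp_all add: smooth_on_bilinear[OF _ bounded_bilinear_mult] open_chart_image smooth_funD
      del: o_apply, simp)

lemma smooth_fun_sum:
  "(\<And>i. i \<in> I \<Longrightarrow> smooth_fun A (h i)) \<Longrightarrow> smooth_fun A (\<lambda>q. \<Sum>i\<in>I. h i q)"
  by (induction I rule: infinite_finite_induct) (auto intro: smooth_fun_add smooth_fun_const)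

lemma smooth_fun_uminus: "smooth_fun A h \<Longrightarrow> smooth_fun A (\<lambda>q. - h q)"
  using smooth_fun_mult[OF smooth_fun_const[of "-1"]] by simp

lemma smooth_fun_diff: "smooth_fun A h \<Longrightarrow> smooth_fun A k \<Longrightarrow> smooth_fun A (\<lambda>q. h q - k q)"
  using smooth_fun_add[OF _ smooth_fun_uminus, of h k] by simp

lemma smooth_vf_add: "smooth_vf A X \<Longrightarrow> smooth_vf A Y \<Longrightarrow> smooth_vf A (\<lambda>q. X q + Y q)"
  by (rule smooth_vfI[where H = "\<lambda>c y. vf_rep A c X y + vf_rep A c Y y"])
    (simp_all add: smooth_on_add open_chart_image smooth_vfD vf_rep_chart linear_add[OF linear_dchart])

lemma smooth_vf_scale: "smooth_fun A h \<Longrightarrow> smooth_vf A X \<Longrightarrow> smooth_vf A (\<lambda>q. h q *\<^sub>R X q)"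
  by (rule smooth_vfI[where H = "\<lambda>c y. (h \<circ> chart_inv c) y *\<^sub>R vf_rep A c X y"])
    (simp_all add: smooth_on_bilinear[OF _ bounded_bilinear_scaleR] open_chart_image smooth_funD
      smooth_vfD del: o_apply, simp add: vf_rep_chart linear.scaleR[OF linear_dchart])

lemma smooth_vf_zero: "smooth_vf A (\<lambda>q. 0)"
  by (rule smooth_vfI[where H = "\<lambda>c y. 0"]) (auto intro: smooth_on_const simp: linear_0[OF linear_dchart])

lemma smooth_vf_scale_const: "smooth_vf A X \<Longrightarrow> smooth_vf A (\<lambda>q. k *\<^sub>R X q)"
  by (rule smooth_vf_scale[OF smooth_fun_const])

lemma smooth_vf_uminus: "smooth_vf A X \<Longrightarrow> smooth_vf A (\<lambda>q. - X q)"
  using smooth_vf_scale_const[of X "-1"] by simp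

lemma smooth_vf_diff: "smooth_vf A X \<Longrightarrow> smooth_vf A Y \<Longrightarrow> smooth_vf A (\<lambda>q. X q - Y q)"
  using smooth_vf_add[OF _ smooth_vf_uminus, of X Y] by simp

lemma smooth_vf_sum:
  "(\<And>i. i \<in> I \<Longrightarrow> smooth_vf A (X i)) \<Longrightarrow> smooth_vf A (\<lambda>q. \<Sum>i\<in>I. X i q)"
  by (induction I rule: infinite_finite_induct) (auto intro: smooth_vf_add smooth_vf_zero)

subsection \<open>Derivations\<close>

lemma smooth_fun_has_derivative:
  "smooth_fun A h \<Longrightarrow> c \<in> A \<Longrightarrow> q \<in> fst c \<Longrightarrow>
    (h \<circ> chart_inv c has_derivative frechet_derivative (h \<circ> chart_inv c) (at (snd c q))) (at (snd c q))"
  by (rule smooth_on_has_derivative[OF smooth_funD]) auto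

lemma smooth_vf_has_derivative:
  "smooth_vf A X \<Longrightarrow> c \<in> A \<Longrightarrow> q \<in> fst c \<Longrightarrow>
    (vf_rep A c X has_derivative frechet_derivative (vf_rep A c X) (at (snd c q))) (at (snd c q))"
  by (rule smooth_on_has_derivative[OF smooth_vfD]) auto

lemma vf_app_eqI:
  "(h \<circ> chart_inv (chart_at A p) has_derivative H) (at (snd (chart_at A p) p)) \<Longrightarrow>
    vf_app A X h p = H (X p)"
  by (simp add: vf_app_def frechet_derivative_eqI)

text \<open>\<open>vf_app\<close> uses at each point that point's own chart. Before its result can
  be differentiated, one chart has to serve all nearby points.\<close>

lemma vf_app_chart:
  assumes "smooth_fun A h" "c \<in> A" "q \<in> fst c"
  shows "vf_app A X h q = frechet_derivative (h \<circ> chart_inv c) (at (snd c q)) (dchart A c q (X q))"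
  unfolding dchart_eq
  by (rule vf_app_eqI chart_change_has_derivative smooth_fun_has_derivative chart_at_in assms)+

lemma smooth_fun_vf_app:
  assumes "smooth_vf A X" "smooth_fun A h"
  shows "smooth_fun A (vf_app A X h)"
  by (rule smooth_funI[where H = "\<lambda>c y. frechet_derivative (h \<circ> chart_inv c) (at y) (vf_rep A c X y)"])
    (simp_all add: assms smooth_on_deriv_apply open_chart_image smooth_funD smooth_vfD vf_app_chart
      vf_rep_chart)

lemma vf_app_add:
  assumes "smooth_fun A h" "smooth_fun A k"
  shows "vf_app A X (\<lambda>q. h q + k q) p = vf_app A X h p + vf_app A X k p"
  using vf_app_eqI[of "\<lambda>q. h q + k q" p _ X]
    has_derivative_add[OF assms[THEN smooth_fun_has_derivative, OF chart_at_in, of p]]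
  by (simp add: vf_app_def o_def)

lemma vf_app_mult:
  assumes "smooth_fun A h" "smooth_fun A k"
  shows "vf_app A X (\<lambda>q. h q * k q) p = vf_app A X h p * k p + h p * vf_app A X k p"
  using vf_app_eqI[of "\<lambda>q. h q * k q" p _ X]
    has_derivative_mult[OF assms[THEN smooth_fun_has_derivative, OF chart_at_in, of p]]
  by (simp add: vf_app_def o_def chart_at_in)

lemma vf_app_const [simp]: "vf_app A X (\<lambda>q. k) p = 0"
  by (simp add: vf_app_def o_def)

lemma vf_app_cmult: "smooth_fun A h \<Longrightarrow> vf_app A X (\<lambda>q. k * h q) p = k * vf_app A X h p"
  using vf_app_mult[OF smooth_fun_const] by simp

lemma vf_app_uminus: "smooth_fun A h \<Longrightarrow> vf_app A X (\<lambda>q. - h q) p = - vf_app A X h p"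
  using vf_app_cmult[of h X "-1"] by simp

lemma vf_app_diff:
  "smooth_fun A h \<Longrightarrow> smooth_fun A k \<Longrightarrow>
    vf_app A X (\<lambda>q. h q - k q) p = vf_app A X h p - vf_app A X k p"
  using vf_app_add[OF _ smooth_fun_uminus, of h k] by (simp add: vf_app_uminus)

lemma vf_app_sum:
  "(\<And>i. i \<in> I \<Longrightarrow> smooth_fun A (h i)) \<Longrightarrow>
    vf_app A X (\<lambda>q. \<Sum>i\<in>I. h i q) p = (\<Sum>i\<in>I. vf_app A X (h i) p)"
  by (induction I rule: infinite_finite_induct) (simp_all add: vf_app_add smooth_fun_sum)

lemma vf_app_linear:
  assumes "smooth_fun A h"
  shows "vf_app A X h p = frechet_derivative (h \<circ> chart_inv (chart_at A p)) (at (snd (chart_at A p) p)) (X p)"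
    "linear (frechet_derivative (h \<circ> chart_inv (chart_at A p)) (at (snd (chart_at A p) p)))"
  using has_derivative_linear[OF smooth_fun_has_derivative[OF assms chart_at_in]]
  by (simp_all add: vf_app_def)

lemma vf_app_add_left:
  "smooth_fun A h \<Longrightarrow> vf_app A (\<lambda>q. X q + Y q) h p = vf_app A X h p + vf_app A Y h p"
  by (simp add: vf_app_linear(1) linear_add[OF vf_app_linear(2)])

text \<open>Each iterated derivative is a second derivative of \<open>h\<close> plus the derivative
  of \<open>h\<close> along a Jacobian term. The second derivatives agree by symmetry, and the
  Jacobian terms form the bracket.\<close>

lemma bracket_app:
  assumes X: "smooth_vf A X" and Y: "smooth_vf A Y" and h: "smooth_fun A h"
  shows "vf_app A (bracket A X Y) h p = vf_app A X (vf_app A Y h) p - vf_app A Y (vf_app A X h) p"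
proof -
  let ?c = "chart_at A p" and ?y = "snd (chart_at A p) p"
  let ?H = "h \<circ> chart_inv ?c"
  let ?S = "snd ?c ` fst ?c"
  have c: "?c \<in> A" "p \<in> fst ?c" "?y \<in> ?S" using chart_at_in by auto
  have id: "dchart A ?c p v = v" for v
    by (simp add: dchart_chart_at[OF atlas])
  have app: "vf_app A X (vf_app A Y h) p
      = frechet_derivative (\<lambda>y. frechet_derivative ?H (at y) (Y p)) (at ?y) (X p)
        + frechet_derivative ?H (at ?y) (frechet_derivative (vf_rep A ?c Y) (at ?y) (X p))"
    if X: "smooth_vf A X" and Y: "smooth_vf A Y" for X Y
  proof -
    have "((\<lambda>y. frechet_derivative ?H (at y) (vf_rep A ?c Y y)) has_derivative
       (\<lambda>v. frechet_derivative (\<lambda>y. frechet_derivative ?H (at y) (vf_rep A ?c Y ?y)) (at ?y) v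
       + frechet_derivative ?H (at ?y) (frechet_derivative (vf_rep A ?c Y) (at ?y) v))) (at ?y)"
      by (rule frechet_derivative_apply[OF open_chart_image[OF c(1)] smooth_funD[OF h c(1)] c(3)
            smooth_vf_has_derivative[OF Y c(1,2)]])
    then have "(vf_app A Y h \<circ> chart_inv ?c has_derivative
       (\<lambda>v. frechet_derivative (\<lambda>y. frechet_derivative ?H (at y) (vf_rep A ?c Y ?y)) (at ?y) v
       + frechet_derivative ?H (at ?y) (frechet_derivative (vf_rep A ?c Y) (at ?y) v))) (at ?y)"
      by (rule has_derivative_transform_within_open[OF _ open_chart_image[OF c(1)] c(3)])
        (use c h in \<open>auto simp: vf_app_chart[OF h c(1)] vf_rep_chart\<close>)
    then show ?thesis
      using c by (simp add: vf_app_eqI vf_rep_chart id)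
  qed
  have "vf_app A (bracket A X Y) h p =
      frechet_derivative ?H (at ?y) (frechet_derivative (vf_rep A ?c Y) (at ?y) (X p))
    - frechet_derivative ?H (at ?y) (frechet_derivative (vf_rep A ?c X) (at ?y) (Y p))"
    by (simp add: vf_app_linear(1)[OF h] bracket_def Let_def linear_diff[OF vf_app_linear(2)[OF h]])
  then show ?thesis
    using second_derivative_symmetric[OF open_chart_image[OF c(1)] smooth_funD[OF h c(1)] c(3), of "Y p" "X p"]
    by (simp add: app[OF X Y] app[OF Y X])
qed

subsection \<open>Extension of local data\<close>

text \<open>An extension by zero is smooth on the overlap with \<open>c\<close> and vanishes off
  \<open>K\<close>; these two open pieces cover each chart \<open>c'\<close>.\<close>

lemma chart_split_images:
  assumes "c \<in> A" "c' \<in> A" "closed K" "K \<subseteq> fst c"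
  shows "snd c' ` fst c' = snd c' ` (fst c' \<inter> fst c) \<union> snd c' ` (fst c' \<inter> - K)"
    "open (snd c' ` (fst c' \<inter> fst c))" "open (snd c' ` (fst c' \<inter> - K))"
  using assms by (auto intro!: open_chart_subimage open_chart_domain)

lemma smooth_fun_extend_by_zero:
  assumes c: "c \<in> A" and K: "closed K" "K \<subseteq> fst c" "\<And>q. q \<notin> K \<Longrightarrow> h q = 0"
    and h: "smooth_on (snd c ` fst c) H" "\<And>q. q \<in> fst c \<Longrightarrow> h q = H (snd c q)"
  shows "smooth_fun A h"
  unfolding smooth_fun_def
proof
  fix c' assume c': "c' \<in> A"
  note s = chart_split_images[OF c c' K(1,2)]
  have "smooth_on (snd c' ` (fst c' \<inter> fst c)) (H \<circ> transition c' c)"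
    by (rule smooth_on_compose[OF s(2) open_chart_image[OF c] _ h(1) transition_smooth[OF c' c]])
      (use c' in auto)
  then have "smooth_on (snd c' ` (fst c' \<inter> fst c)) (h \<circ> chart_inv c')"
    by (subst smooth_on_cong[OF s(2), where h' = "H \<circ> transition c' c"]) (use c' h(2) in auto)
  moreover have "smooth_on (snd c' ` (fst c' \<inter> - K)) (h \<circ> chart_inv c')"
    by (subst smooth_on_cong[OF s(3), where h' = "\<lambda>y. 0"]) (use c' K(3) smooth_on_const in auto)
  ultimately show "smooth_on (snd c' ` fst c') (h \<circ> chart_inv c')"
    unfolding s(1) by (rule smooth_on_Un[OF s(2,3)])
qed

lemma smooth_vf_extend_by_zero:
  assumes c: "c \<in> A" and K: "closed K" "K \<subseteq> fst c" "\<And>q. q \<notin> K \<Longrightarrow> X q = 0"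
    and X: "smooth_on (snd c ` fst c) H" "\<And>q. q \<in> fst c \<Longrightarrow> dchart A c q (X q) = H (snd c q)"
  shows "smooth_vf A X"
  unfolding smooth_vf_def
proof
  fix c' assume c': "c' \<in> A"
  note s = chart_split_images[OF c c' K(1,2)]
  let ?W = "\<lambda>y. frechet_derivative (transition c c') (at y) (H y)"
  have "smooth_on (snd c ` (fst c \<inter> fst c')) ?W"
    by (intro smooth_on_deriv_apply open_chart_subimage open_chart_domain c c' transition_smooth
        smooth_on_subset[OF X(1)]) auto
  then have "smooth_on (snd c' ` (fst c' \<inter> fst c)) (?W \<circ> transition c' c)"
    by (rule smooth_on_compose[OF s(2) open_chart_subimage[OF c open_chart_domain[OF c']] _ _
          transition_smooth[OF c' c], rotated]) (use c' in auto)
  then have "smooth_on (snd c' ` (fst c' \<inter> fst c)) (vf_rep A c' X)"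
    by (subst smooth_on_cong[OF s(2), where h' = "?W \<circ> transition c' c"])
      (use c c' X(2) in \<open>auto simp: vf_rep_chart dchart_change[OF c c'] simp del: o_apply, auto\<close>)
  moreover have "smooth_on (snd c' ` (fst c' \<inter> - K)) (vf_rep A c' X)"
    by (subst smooth_on_cong[OF s(3), where h' = "\<lambda>y. 0"])
      (use c' K(3) smooth_on_const in \<open>auto simp: vf_rep_chart linear_0[OF linear_dchart]\<close>)
  ultimately show "smooth_on (snd c' ` fst c') (vf_rep A c' X)"
    unfolding s(1) by (rule smooth_on_Un[OF s(2,3)])
qed

lemma manifold_bump:
  assumes c: "c \<in> A" "p \<in> fst c"
  obtains b W K where "smooth_on UNIV b" "open W" "p \<in> W" "W \<subseteq> fst c" "closed K" "K \<subseteq> fst c"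
    "\<And>q. q \<in> W \<Longrightarrow> b (snd c q) = (1::real)" "\<And>q. q \<in> fst c \<Longrightarrow> q \<notin> K \<Longrightarrow> b (snd c q) = 0"
proof -
  let ?y = "snd c p"
  obtain e where e: "e > 0" "cball ?y e \<subseteq> snd c ` fst c"
    using open_chart_image[OF c(1)] c(2) open_contains_cball by blast
  obtain b :: "real ^ 'd \<Rightarrow> real" where b: "smooth_on UNIV b" "\<And>y. y \<in> ball ?y (e / 2) \<Longrightarrow> b y = 1"
    "\<And>y. y \<notin> cball ?y (2 * (e / 2)) \<Longrightarrow> b y = 0"
    using bump_function_exists[of "e / 2" ?y] e(1) by auto
  have hom: "continuous_on (fst c) (snd c)" "continuous_on (snd c ` fst c) (chart_inv c)"
    using chart_homeomorphism[OF c(1)] by (auto simp: homeomorphism_def)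
  define K where "K = chart_inv c ` cball ?y e"
  define W where "W = fst c \<inter> snd c -` ball ?y (e / 2)"
  show ?thesis
  proof (rule that[of b W K])
    \<comment> \<open>Compactness makes \<open>K\<close> closed in the whole Hausdorff space and not
      merely in the chart domain.\<close>
    have "compact K"
      unfolding K_def by (intro compact_continuous_image continuous_on_subset[OF hom(2)] e compact_cball)
    then show "closed K" by (rule compact_imp_closed)
    show "K \<subseteq> fst c" using e(2) c(1) by (auto simp: K_def subset_iff)
    show "open W"
      unfolding W_def using continuous_on_open_vimage[OF open_chart_domain[OF c(1)]] hom(1)
      by (metis Int_commute open_ball)
    show "p \<in> W" "W \<subseteq> fst c" using c e by (auto simp: W_def)
    show "b (snd c q) = 0" if "q \<in> fst c" "q \<notin> K" for q
    proof (rule b(3))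
      show "snd c q \<notin> cball ?y (2 * (e / 2))"
        using that chart_inv_chart[OF c(1) that(1)] by (metis K_def field_sum_of_halves image_eqI mult_2)
    qed
  qed (use b in \<open>auto simp: W_def\<close>)
qed

text \<open>Cut-off coordinates: on \<open>W\<close>, where \<phi> is 1, the fields
  \<open>E i\<close> are the coordinate frame, and the last two clauses concern the coordinates and
  the components of a field. All of it is global, since the rules for \<open>D\<close> and
  \<open>vf_app\<close> speak of global smooth objects.\<close>

definition bump_frame ::
  "('m, 'd) chart \<Rightarrow> 'm \<Rightarrow> ('m \<Rightarrow> real) \<Rightarrow> 'm set \<Rightarrow> ('d \<Rightarrow> ('m, 'd) vfield) \<Rightarrow> bool" where
  "bump_frame c p \<phi> W E \<longleftrightarrow>
    smooth_fun A \<phi> \<and> open W \<and> p \<in> W \<and> W \<subseteq> fst c \<and>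
    (\<forall>q\<in>W. \<phi> q = 1) \<and> (\<forall>q. q \<notin> fst c \<longrightarrow> \<phi> q = 0) \<and>
    (\<forall>i. smooth_vf A (E i)) \<and>
    (\<forall>i. \<forall>q\<in>fst c. dchart A c q (E i q) = \<phi> q *\<^sub>R axis i 1) \<and>
    (\<forall>i q. q \<notin> fst c \<longrightarrow> E i q = 0) \<and>
    (\<forall>i. smooth_fun A (\<lambda>q. \<phi> q * snd c q $ i)) \<and>
    (\<forall>i X. smooth_vf A X \<longrightarrow> smooth_fun A (\<lambda>q. \<phi> q * dchart A c q (X q) $ i))"

lemma bump_frameD:
  assumes "bump_frame c p \<phi> W E"
  shows "smooth_fun A \<phi>" "open W" "p \<in> W" "W \<subseteq> fst c"
    "q \<in> W \<Longrightarrow> \<phi> q = 1" "q \<notin> fst c \<Longrightarrow> \<phi> q = 0"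
    "smooth_vf A (E i)"
    "q \<in> fst c \<Longrightarrow> dchart A c q (E i q) = \<phi> q *\<^sub>R axis i 1"
    "q \<notin> fst c \<Longrightarrow> E i q = 0"
    "smooth_fun A (\<lambda>q. \<phi> q * snd c q $ i)"
    "smooth_vf A X \<Longrightarrow> smooth_fun A (\<lambda>q. \<phi> q * dchart A c q (X q) $ i)"
  using assms by (simp_all add: bump_frame_def)

lemma bump_frame_exists:
  assumes c: "c \<in> A" "p \<in> fst c"
  obtains \<phi> W E where "bump_frame c p \<phi> W E"
proof -
  obtain b W K where b: "smooth_on UNIV b" "open W" "p \<in> W" "W \<subseteq> fst c" "closed K" "K \<subseteq> fst c"
    "\<And>q. q \<in> W \<Longrightarrow> b (snd c q) = (1::real)" "\<And>q. q \<in> fst c \<Longrightarrow> q \<notin> K \<Longrightarrow> b (snd c q) = 0"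
    using manifold_bump[OF c] by metis
  define \<phi> where "\<phi> q = (if q \<in> fst c then b (snd c q) else 0)" for q
  define E where "E i q = (if q \<in> fst c then \<phi> q *\<^sub>R dchart_inv c q (axis i 1) else 0)" for i q
  have \<phi>0: "\<phi> q = 0" if "q \<notin> K" for q using b that by (auto simp: \<phi>_def)
  let ?S = "snd c ` fst c"
  have op: "open ?S" and sb: "smooth_on ?S b"
    using open_chart_image[OF c(1)] smooth_on_subset[OF b(1)] by auto
  have nth: "smooth_on ?S (\<lambda>y. h y $ i)" if "smooth_on ?S h" for h :: "real ^ 'd \<Rightarrow> real ^ 'd" and i
    using smooth_on_compose[OF op open_UNIV _ smooth_on_bounded_linear[OF open_UNIV bounded_linear_vec_nth] that, of i]
    by (simp add: o_def)
  have ext: "smooth_fun A (\<lambda>q. \<phi> q * h q)"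
    if "smooth_on ?S H" "\<And>q. q \<in> fst c \<Longrightarrow> h q = H (snd c q)" for h H
    by (rule smooth_fun_extend_by_zero[OF c(1) b(5,6) _
          smooth_on_bilinear[OF op bounded_bilinear_mult sb that(1)]])
      (use \<phi>0 that(2) in \<open>auto simp: \<phi>_def\<close>)
  have "bump_frame c p \<phi> W E"
    unfolding bump_frame_def
  proof (intro conjI allI impI ballI)
    show "smooth_fun A \<phi>"
      using ext[OF smooth_on_const[of _ 1], of "\<lambda>_. 1"] by simp
    show "smooth_vf A (E i)" for i
      by (rule smooth_vf_extend_by_zero[OF c(1) b(5,6) _
            smooth_on_bilinear[OF op bounded_bilinear_scaleR sb smooth_on_const[of _ "axis i 1"]]])
        (use b(8) c(1) in \<open>auto simp: E_def \<phi>_def linear.scaleR[OF linear_dchart] dchart_dchart_inv\<close>)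
    show "smooth_fun A (\<lambda>q. \<phi> q * snd c q $ i)" for i
      by (rule ext[OF nth[OF smooth_on_bounded_linear[OF op bounded_linear_ident]]]) simp
    show "smooth_fun A (\<lambda>q. \<phi> q * dchart A c q (X q) $ i)" if "smooth_vf A X" for i X
      by (rule ext[OF nth[OF smooth_vfD[OF that c(1)]]]) (simp add: vf_rep_chart c(1))
  qed (use b c in \<open>auto simp: \<phi>_def E_def linear.scaleR[OF linear_dchart] dchart_dchart_inv\<close>)
  then show ?thesis by (rule that)
qed

lemma dchart_inject:
  "c \<in> A \<Longrightarrow> q \<in> fst c \<Longrightarrow> dchart A c q v = dchart A c q w \<Longrightarrow> v = w"
  by (metis dchart_inv_dchart)

lemma dchart_chart_at_self [simp]: "dchart A (chart_at A p) p v = v"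
  by (simp add: dchart_chart_at[OF atlas])

text \<open>Gives the choice in \<open>endo_at\<close> a witness, and lets identities between
  tangent vectors be proved for fields.\<close>

lemma extension_exists: "\<exists>Z. smooth_vf A Z \<and> Z p = z"
proof -
  obtain \<phi> W E where E: "bump_frame (chart_at A p) p \<phi> W E"
    using bump_frame_exists[OF chart_at_in] .
  have "E i p = axis i 1" for i
    using bump_frameD(8)[OF E chart_at_in(2), of i] bump_frameD(3,5)[OF E] by simp
  then have "(\<Sum>i\<in>UNIV. z $ i *\<^sub>R E i p) = z"
    using basis_expansion[of z] by (simp add: scalar_mult_eq_scaleR)
  moreover have "smooth_vf A (\<lambda>q. \<Sum>i\<in>UNIV. z $ i *\<^sub>R E i q)"
    by (intro smooth_vf_sum smooth_vf_scale_const bump_frameD(7)[OF E])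
  ultimately show ?thesis by blast
qed

text \<open>The cut-off coordinate functions are smooth on all of the manifold, and their
  derivatives at \<open>p\<close> are the components of the vector.\<close>

lemma vf_eqI:
  assumes "\<And>h. smooth_fun A h \<Longrightarrow> vf_app A X h p = vf_app A Y h p"
  shows "X p = Y p"
proof -
  let ?c = "chart_at A p"
  obtain \<phi> W E where E: "bump_frame ?c p \<phi> W E"
    using bump_frame_exists[OF chart_at_in] .
  note W = bump_frameD(2-5,10)[OF E]
  have "vf_app A X (\<lambda>q. \<phi> q * snd ?c q $ i) p = X p $ i" for X i
  proof (rule vf_app_eqI)
    show "((\<lambda>q. \<phi> q * snd ?c q $ i) \<circ> chart_inv ?c has_derivative (\<lambda>v. v $ i)) (at (snd ?c p))"
      by (rule has_derivative_transform_within_open[OF has_derivative_vec_nth[OF has_derivative_ident]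
            open_chart_subimage[OF chart_at_in(1) W(1)]])
        (use W chart_at_in in auto)
  qed
  then show ?thesis using assms[OF W(5)] by (simp add: vec_eq_iff)
qed

text \<open>Both sides act on functions as the same commutator of derivations. The brackets are
  assumed smooth here; \<open>smooth_bracket\<close> provides this once a torsion-free connection is
  present.\<close>

lemma jacobi_identity:
  assumes X: "smooth_vf A X" and Y: "smooth_vf A Y" and Z: "smooth_vf A Z"
    and XY: "smooth_vf A (bracket A X Y)" and YZ: "smooth_vf A (bracket A Y Z)"
    and XZ: "smooth_vf A (bracket A X Z)"
  shows "bracket A X (bracket A Y Z) p = bracket A (bracket A X Y) Z p + bracket A Y (bracket A X Z) p"
proof -
  have fn: "vf_app A (bracket A X Y) h = (\<lambda>q. vf_app A X (vf_app A Y h) q - vf_app A Y (vf_app A X h) q)"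
    if "smooth_vf A X" "smooth_vf A Y" "smooth_fun A h" for X Y h
    using bracket_app[OF that] by auto
  show ?thesis
    by (rule vf_eqI[where Y = "\<lambda>p. bracket A (bracket A X Y) Z p + bracket A Y (bracket A X Z) p"])
      (simp add: assms fn vf_app_add_left vf_app_diff smooth_fun_vf_app smooth_fun_diff)
qed

subsection \<open>Tensorial operators and their traces\<close>

definition tensorial :: "(('m, 'd) vfield \<Rightarrow> ('m, 'd) vfield) \<Rightarrow> bool" where
  "tensorial \<Phi> \<longleftrightarrow>
    (\<forall>Z. smooth_vf A Z \<longrightarrow> smooth_vf A (\<Phi> Z)) \<and>
    (\<forall>Z Z'. smooth_vf A Z \<and> smooth_vf A Z' \<longrightarrow> (\<forall>p. \<Phi> (\<lambda>q. Z q + Z' q) p = \<Phi> Z p + \<Phi> Z' p)) \<and>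
    (\<forall>h Z. smooth_fun A h \<and> smooth_vf A Z \<longrightarrow> (\<forall>p. \<Phi> (\<lambda>q. h q *\<^sub>R Z q) p = h p *\<^sub>R \<Phi> Z p))"

lemma tensorialD:
  assumes "tensorial \<Phi>"
  shows tensorial_smooth: "smooth_vf A Z \<Longrightarrow> smooth_vf A (\<Phi> Z)"
    and tensorial_add: "smooth_vf A Z \<Longrightarrow> smooth_vf A Z' \<Longrightarrow> \<Phi> (\<lambda>q. Z q + Z' q) p = \<Phi> Z p + \<Phi> Z' p"
    and tensorial_scale: "smooth_fun A h \<Longrightarrow> smooth_vf A Z \<Longrightarrow> \<Phi> (\<lambda>q. h q *\<^sub>R Z q) p = h p *\<^sub>R \<Phi> Z p"
  using assms unfolding tensorial_def by blast+

lemma tensorial_sum: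
  assumes "tensorial \<Phi>" "finite I" "\<And>i. i \<in> I \<Longrightarrow> smooth_vf A (Z i)"
  shows "\<Phi> (\<lambda>q. \<Sum>i\<in>I. Z i q) p = (\<Sum>i\<in>I. \<Phi> (Z i) p)"
  using assms(2,3)
proof (induction I)
  case empty
  show ?case
    using tensorial_scale[OF assms(1) smooth_fun_const[of 0] smooth_vf_zero] by simp
next
  case (insert i I)
  then show ?case by (simp add: tensorial_add[OF assms(1)] smooth_vf_sum)
qed

text \<open>\<phi>^2 Z is a combination of the \<open>E i\<close> whose coefficients vanish at
  \<open>p\<close>: one factor \<phi> makes the components of \<open>Z\<close> global, the other
  sits inside \<open>E i\<close>, and both are 1 at \<open>p\<close>.\<close>

lemma tensorial_vanish:
  assumes "tensorial \<Phi>" "smooth_vf A Z" "Z p = 0"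
  shows "\<Phi> Z p = 0"
proof -
  let ?c = "chart_at A p"
  obtain \<phi> W E where "bump_frame ?c p \<phi> W E"
    using bump_frame_exists[OF chart_at_in] .
  note E = bump_frameD(1,3,5-9,11)[OF this]
  let ?u = "\<lambda>i q. \<phi> q * dchart A ?c q (Z q) $ i"
  have "(\<Sum>i\<in>UNIV. ?u i q *\<^sub>R E i q) = (\<phi> q * \<phi> q) *\<^sub>R Z q" for q
  proof (cases "q \<in> fst ?c")
    case True
    let ?d = "dchart A ?c q"
    have L: "linear ?d" by (rule linear_dchart[OF chart_at_in(1) True])
    have "?d (\<Sum>i\<in>UNIV. ?u i q *\<^sub>R E i q) = (\<Sum>i\<in>UNIV. (\<phi> q * \<phi> q) *\<^sub>R (?d (Z q) $ i *\<^sub>R axis i 1))"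
      by (simp add: linear_sum[OF L] linear.scaleR[OF L] E(6)[OF True] ac_simps)
    also have "\<dots> = (\<phi> q * \<phi> q) *\<^sub>R ?d (Z q)"
      by (subst scaleR_sum_right[symmetric]) (simp only: basis_expansion flip: scalar_mult_eq_scaleR)
    also have "\<dots> = ?d ((\<phi> q * \<phi> q) *\<^sub>R Z q)"
      by (rule linear.scaleR[OF L, symmetric])
    finally show ?thesis
      by (rule dchart_inject[OF chart_at_in(1) True])
  qed (simp add: E)
  then have "(\<phi> p * \<phi> p) *\<^sub>R \<Phi> Z p = \<Phi> (\<lambda>q. \<Sum>i\<in>UNIV. ?u i q *\<^sub>R E i q) p"
    by (simp add: tensorial_scale[OF assms(1)] smooth_fun_mult E assms)
  also have "\<dots> = (\<Sum>i\<in>UNIV. ?u i p *\<^sub>R \<Phi> (E i) p)"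
    by (subst tensorial_sum[OF assms(1)])
      (simp_all add: tensorial_scale[OF assms(1)] smooth_vf_scale E assms)
  also have "\<dots> = 0" by (simp add: assms(3))
  finally show ?thesis using E(2,3) by simp
qed

lemma tensorial_local:
  assumes "tensorial \<Phi>" "smooth_vf A Z" "smooth_vf A Z'" "Z p = Z' p"
  shows "\<Phi> Z p = \<Phi> Z' p"
proof -
  have "\<Phi> (\<lambda>q. Z q + (-1) *\<^sub>R Z' q) p = \<Phi> Z p + (-1) *\<^sub>R \<Phi> Z' p"
    using tensorial_add[OF assms(1,2) smooth_vf_scale_const[OF assms(3), of "-1"], of p]
      tensorial_scale[OF assms(1) smooth_fun_const[of "-1"] assms(3), of p] by simp
  moreover have "\<Phi> (\<lambda>q. Z q + (-1) *\<^sub>R Z' q) p = 0"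
    by (rule tensorial_vanish[OF assms(1)])
      (intro smooth_vf_add smooth_vf_scale_const, use assms in auto)
  ultimately show ?thesis by simp
qed

lemma endo_at_eq:
  assumes "tensorial \<Phi>" "smooth_vf A Z" "Z p = z"
  shows "endo_at A \<Phi> p z = \<Phi> Z p"
proof -
  have "smooth_vf A (SOME Z. smooth_vf A Z \<and> Z p = z) \<and> (SOME Z. smooth_vf A Z \<and> Z p = z) p = z"
    using someI_ex[OF extension_exists] .
  then show ?thesis
    unfolding endo_at_def by (intro tensorial_local[OF assms(1) _ assms(2)]) (simp_all only: assms(3))
qed

lemma linear_endo_at:
  assumes "tensorial \<Phi>"
  shows "linear (endo_at A \<Phi> p)"
proof (rule linearI)
  fix x y r
  obtain X Y where X: "smooth_vf A X" "X p = x" and Y: "smooth_vf A Y" "Y p = y"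
    using extension_exists by metis
  show "endo_at A \<Phi> p (x + y) = endo_at A \<Phi> p x + endo_at A \<Phi> p y"
    using endo_at_eq[OF assms smooth_vf_add[OF X(1) Y(1)], of p] X Y
    by (simp add: endo_at_eq[OF assms X] endo_at_eq[OF assms Y] tensorial_add[OF assms])
  show "endo_at A \<Phi> p (r *\<^sub>R x) = r *\<^sub>R endo_at A \<Phi> p x"
    using endo_at_eq[OF assms smooth_vf_scale_const[OF X(1)], of r p] X
    by (simp add: endo_at_eq[OF assms X] tensorial_scale[OF assms smooth_fun_const])
qed

text \<open>The extension chosen inside the trace is always smooth, so agreement on smooth fields
  suffices.\<close>

lemma vf_trace_cong:
  assumes "\<And>Z. smooth_vf A Z \<Longrightarrow> \<Phi> Z p = \<Psi> Z p"
  shows "vf_trace A \<Phi> p = vf_trace A \<Psi> p"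
proof -
  have "smooth_vf A (SOME Z. smooth_vf A Z \<and> Z p = z)" for z
    using someI_ex[OF extension_exists[of p z]] by blast
  then have "endo_at A \<Phi> p = endo_at A \<Psi> p"
    using assms by (auto simp: endo_at_def)
  then show ?thesis by (simp add: vf_trace_def)
qed

text \<open>The same chosen extension enters all three traces.\<close>

lemma vf_trace_add: "vf_trace A (\<lambda>Z q. \<Phi> Z q + \<Psi> Z q) p = vf_trace A \<Phi> p + vf_trace A \<Psi> p"
  by (simp add: vf_trace_def trace_matrix endo_at_def sum.distrib)

lemma vf_trace_scale: "vf_trace A (\<lambda>Z q. k q *\<^sub>R \<Phi> Z q) p = k p * vf_trace A \<Phi> p"
  by (simp add: vf_trace_def trace_matrix endo_at_def sum_distrib_left)

lemma vf_trace_rank_one: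
  assumes "linear (\<alpha> p)"
  shows "vf_trace A (\<lambda>Z q. \<alpha> q (Z q) *\<^sub>R v q) p = \<alpha> p (v p)"
proof -
  have "(SOME Z. smooth_vf A Z \<and> Z p = z) p = z" for z
    using someI_ex[OF extension_exists[of p z]] by blast
  then show ?thesis
    using trace_matrix_rank_one[OF assms] by (simp add: vf_trace_def endo_at_def[abs_def])
qed

end

subsection \<open>The Levi-Civita connection\<close>

locale riemannian_manifold = smooth_manifold A
  for A :: "('m::{t2_space,second_countable_topology}, 'd::finite) chart set" +
  fixes g :: "('m, 'd) form2" and D :: "('m, 'd) conn"
  assumes metric: "riemannian_metric A g" and levi_civita: "levi_civita A g D"
begin

lemma bilinear_metric: "bilinear (g p)"
  using metric by (simp add: riemannian_metric_def)

lemmas metric_simps =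
  bilinear_ladd[OF bilinear_metric] bilinear_radd[OF bilinear_metric]
  bilinear_lsub[OF bilinear_metric] bilinear_rsub[OF bilinear_metric]
  bilinear_lmul[OF bilinear_metric, unfolded real_scaleR_def]
  bilinear_rmul[OF bilinear_metric, unfolded real_scaleR_def]
  bilinear_lneg[OF bilinear_metric] bilinear_rneg[OF bilinear_metric]
  bilinear_lzero[OF bilinear_metric] bilinear_rzero[OF bilinear_metric]

lemma metric_sum_left: "g p (\<Sum>i\<in>I. x i) y = (\<Sum>i\<in>I. g p (x i) y)"
  by (induction I rule: infinite_finite_induct) (simp_all add: metric_simps)

lemma metric_sum_right: "g p y (\<Sum>i\<in>I. x i) = (\<Sum>i\<in>I. g p y (x i))"
  by (induction I rule: infinite_finite_induct) (simp_all add: metric_simps)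

lemma metric_sym: "g p x y = g p y x"
  using metric by (simp add: riemannian_metric_def)

lemma metric_pos: "x \<noteq> 0 \<Longrightarrow> g p x x > 0"
  using metric by (simp add: riemannian_metric_def)

lemma metric_eqI:
  assumes "\<And>z. g p x z = g p y z"
  shows "x = y"
proof (rule ccontr)
  assume "x \<noteq> y"
  then have "g p (x - y) (x - y) > 0" by (intro metric_pos) simp
  moreover have "g p (x - y) (x - y) = 0" by (simp only: metric_simps assms)
  ultimately show False by simp
qed

lemma smooth_metric: "smooth_vf A X \<Longrightarrow> smooth_vf A Y \<Longrightarrow> smooth_fun A (\<lambda>p. g p (X p) (Y p))"
  using metric by (simp add: riemannian_metric_def)

lemma connection: "affine_connection A D"
  using levi_civita by (simp add: levi_civita_def)

lemma smooth_D: "smooth_vf A X \<Longrightarrow> smooth_vf A Y \<Longrightarrow> smooth_vf A (D X Y)"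
  using connection by (simp add: affine_connection_def)

lemma D_add_left:
  "smooth_vf A X \<Longrightarrow> smooth_vf A X' \<Longrightarrow> smooth_vf A Y \<Longrightarrow> D (\<lambda>q. X q + X' q) Y p = D X Y p + D X' Y p"
  using connection by (simp add: affine_connection_def)

lemma D_scale_left:
  "smooth_fun A h \<Longrightarrow> smooth_vf A X \<Longrightarrow> smooth_vf A Y \<Longrightarrow> D (\<lambda>q. h q *\<^sub>R X q) Y p = h p *\<^sub>R D X Y p"
  using connection by (simp add: affine_connection_def)

lemma D_add:
  "smooth_vf A X \<Longrightarrow> smooth_vf A Y \<Longrightarrow> smooth_vf A Y' \<Longrightarrow> D X (\<lambda>q. Y q + Y' q) p = D X Y p + D X Y' p"
  using connection by (simp add: affine_connection_def)

lemma D_scale: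
  "smooth_fun A h \<Longrightarrow> smooth_vf A X \<Longrightarrow> smooth_vf A Y \<Longrightarrow>
    D X (\<lambda>q. h q *\<^sub>R Y q) p = vf_app A X h p *\<^sub>R Y p + h p *\<^sub>R D X Y p"
  using connection by (simp add: affine_connection_def)

lemma D_cscale:
  "smooth_vf A X \<Longrightarrow> smooth_vf A Y \<Longrightarrow> D X (\<lambda>q. k *\<^sub>R Y q) p = k *\<^sub>R D X Y p"
  using D_scale[OF smooth_fun_const] by simp

lemma D_zero: "smooth_vf A X \<Longrightarrow> D X (\<lambda>q. 0) p = 0"
  using D_cscale[of X "\<lambda>q. 0" 0 p] by (simp add: smooth_vf_zero)

lemma D_sum:
  assumes "smooth_vf A X" "\<And>i. i \<in> I \<Longrightarrow> smooth_vf A (Y i)"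
  shows "D X (\<lambda>q. \<Sum>i\<in>I. Y i q) p = (\<Sum>i\<in>I. D X (Y i) p)"
  using assms(2)
  by (induction I rule: infinite_finite_induct) (simp_all add: D_zero D_add assms(1) smooth_vf_sum)

lemma bracket_eq: "smooth_vf A X \<Longrightarrow> smooth_vf A Y \<Longrightarrow> bracket A X Y p = D X Y p - D Y X p"
  using levi_civita by (simp add: levi_civita_def)

lemma metric_compatible:
  "smooth_vf A X \<Longrightarrow> smooth_vf A Y \<Longrightarrow> smooth_vf A Z \<Longrightarrow>
    vf_app A X (\<lambda>q. g q (Y q) (Z q)) p = g p (D X Y p) (Z p) + g p (Y p) (D X Z p)"
  using levi_civita by (simp add: levi_civita_def)

lemma smooth_bracket: "smooth_vf A X \<Longrightarrow> smooth_vf A Y \<Longrightarrow> smooth_vf A (bracket A X Y)"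
proof -
  assume *: "smooth_vf A X" "smooth_vf A Y"
  then have "bracket A X Y = (\<lambda>p. D X Y p - D Y X p)" by (auto simp: bracket_eq)
  then show ?thesis using * by (simp add: smooth_vf_diff smooth_D)
qed

lemma bracket_add:
  "smooth_vf A X \<Longrightarrow> smooth_vf A Y \<Longrightarrow> smooth_vf A Y' \<Longrightarrow>
    bracket A X (\<lambda>q. Y q + Y' q) p = bracket A X Y p + bracket A X Y' p"
  by (simp add: bracket_eq smooth_vf_add D_add D_add_left)

lemma bracket_scale:
  "smooth_fun A h \<Longrightarrow> smooth_vf A X \<Longrightarrow> smooth_vf A Y \<Longrightarrow>
    bracket A X (\<lambda>q. h q *\<^sub>R Y q) p = vf_app A X h p *\<^sub>R Y p + h p *\<^sub>R bracket A X Y p"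
  by (simp add: bracket_eq smooth_vf_scale D_scale D_scale_left algebra_simps)

lemma jacobi:
  "smooth_vf A X \<Longrightarrow> smooth_vf A Y \<Longrightarrow> smooth_vf A Z \<Longrightarrow>
    bracket A X (bracket A Y Z) p = bracket A (bracket A X Y) Z p + bracket A Y (bracket A X Z) p"
  by (rule jacobi_identity) (simp_all add: smooth_bracket)

text \<open>The operator is the Lie derivative of \<Phi> along \<open>X\<close>; when
  \<open>Z\<close> is multiplied by \<open>h\<close>, the two terms containing X h cancel.\<close>

lemma tensorial_lie_derivative:
  assumes \<Phi>: "tensorial \<Phi>" and X: "smooth_vf A X"
  shows "tensorial (\<lambda>Z q. bracket A X (\<Phi> Z) q - \<Phi> (bracket A X Z) q)"
  unfolding tensorial_def
proof (intro conjI allI impI; (elim conjE)?)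
  fix Z assume Z: "smooth_vf A Z"
  then show "smooth_vf A (\<lambda>q. bracket A X (\<Phi> Z) q - \<Phi> (bracket A X Z) q)"
    by (intro smooth_vf_diff smooth_bracket tensorial_smooth[OF \<Phi>] X)
next
  fix Z Z' p assume Z: "smooth_vf A Z" "smooth_vf A Z'"
  have "\<Phi> (\<lambda>q. Z q + Z' q) = (\<lambda>q. \<Phi> Z q + \<Phi> Z' q)"
    "bracket A X (\<lambda>q. Z q + Z' q) = (\<lambda>q. bracket A X Z q + bracket A X Z' q)"
    using Z X by (auto simp: tensorial_add[OF \<Phi>] bracket_add)
  then show "bracket A X (\<Phi> (\<lambda>q. Z q + Z' q)) p - \<Phi> (bracket A X (\<lambda>q. Z q + Z' q)) p =
    bracket A X (\<Phi> Z) p - \<Phi> (bracket A X Z) p + (bracket A X (\<Phi> Z') p - \<Phi> (bracket A X Z') p)"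
    using Z X by (simp add: bracket_add tensorial_add[OF \<Phi>] tensorial_smooth[OF \<Phi>] smooth_bracket)
next
  fix h Z p assume Z: "smooth_fun A h" "smooth_vf A Z"
  have "\<Phi> (\<lambda>q. h q *\<^sub>R Z q) = (\<lambda>q. h q *\<^sub>R \<Phi> Z q)"
    "bracket A X (\<lambda>q. h q *\<^sub>R Z q) = (\<lambda>q. vf_app A X h q *\<^sub>R Z q + h q *\<^sub>R bracket A X Z q)"
    using Z X by (auto simp: tensorial_scale[OF \<Phi>] bracket_scale)
  then show "bracket A X (\<Phi> (\<lambda>q. h q *\<^sub>R Z q)) p - \<Phi> (bracket A X (\<lambda>q. h q *\<^sub>R Z q)) p =
    h p *\<^sub>R (bracket A X (\<Phi> Z) p - \<Phi> (bracket A X Z) p)"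
    using Z X by (simp add: bracket_scale tensorial_add[OF \<Phi>] tensorial_scale[OF \<Phi>] tensorial_smooth[OF \<Phi>]
        smooth_bracket smooth_vf_scale smooth_fun_vf_app algebra_simps)
qed

text \<open>In the distinguished chart at \<open>p\<close> the bracket of \<open>X\<close> with a coordinate field is minus a
  column of the Jacobian of \<open>X\<close>, so the two Jacobian terms cancel by \<open>trace (L M) = trace (M L)\<close>.\<close>

lemma vf_app_vf_trace:
  assumes \<Phi>: "tensorial \<Phi>" and X: "smooth_vf A X"
  shows "vf_app A X (vf_trace A \<Phi>) p = vf_trace A (\<lambda>Z q. bracket A X (\<Phi> Z) q - \<Phi> (bracket A X Z) q) p"
proof -
  let ?c = "chart_at A p" and ?y = "snd (chart_at A p) p"
  have c: "?c \<in> A" "p \<in> fst ?c" by (rule chart_at_in)+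
  obtain \<phi> W E where "bump_frame ?c p \<phi> W E"
    using bump_frame_exists[OF c] .
  note E = bump_frameD(2-5,7,8)[OF this]
  let ?U = "snd ?c ` (fst ?c \<inter> W)"
  have U: "open ?U" "?y \<in> ?U" using open_chart_subimage[OF c(1) E(1)] c E by auto
  have dE: "dchart A ?c q (E i q) = axis i 1" if "q \<in> W" for i q
    using E that by auto
  have Ep: "E i p = axis i 1" for i using dE[OF E(2)] by simp
  let ?r = "vf_rep A ?c"
  let ?J = "\<lambda>Y. frechet_derivative (?r Y) (at ?y)"
  \<comment> \<open>The trace at \<open>q\<close> refers to the chart chosen at \<open>q\<close>;
    conjugation with \<open>dchart\<close> preserves it and moves it to the one chart around
    \<open>p\<close>, where it can be differentiated.\<close>
  have tr: "vf_trace A \<Phi> q = (\<Sum>i\<in>UNIV. ?r (\<Phi> (E i)) (snd ?c q) $ i)" if q: "q \<in> W" for q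
  proof -
    have qc: "q \<in> fst ?c" using E q by auto
    let ?L = "endo_at A \<Phi> q" and ?d = "dchart A ?c q" and ?i = "dchart_inv ?c q"
    have lin: "linear ?L" "linear ?d" "linear ?i"
      by (rule linear_endo_at[OF \<Phi>] linear_dchart[OF c(1) qc] linear_dchart_inv[OF c(1) qc])+
    have iE: "?i (axis i 1) = E i q" for i
      by (metis dE[OF q] dchart_inv_dchart[OF c(1) qc])
    have "?L = ?i \<circ> (?d \<circ> ?L)" by (auto simp: dchart_inv_dchart[OF c(1) qc])
    then have "vf_trace A \<Phi> q = trace (matrix ((?d \<circ> ?L) \<circ> ?i))"
      unfolding vf_trace_def
      by (metis trace_matrix_compose_commute[OF lin(3) linear_compose[OF lin(1,2)]])
    also have "\<dots> = (\<Sum>i\<in>UNIV. ?d (?L (E i q)) $ i)" by (simp add: trace_matrix iE)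
    also have "\<dots> = (\<Sum>i\<in>UNIV. ?r (\<Phi> (E i)) (snd ?c q) $ i)"
      by (simp add: endo_at_eq[OF \<Phi> E(5)] vf_rep_chart[OF c(1) qc])
    finally show ?thesis .
  qed
  have J: "(?r Y has_derivative ?J Y) (at ?y)" if "smooth_vf A Y" for Y
    by (rule smooth_vf_has_derivative[OF that c])
  have lhs: "vf_app A X (vf_trace A \<Phi>) p = (\<Sum>i\<in>UNIV. ?J (\<Phi> (E i)) (X p) $ i)"
  proof (rule vf_app_eqI)
    have "((\<lambda>y. \<Sum>i\<in>UNIV. ?r (\<Phi> (E i)) y $ i) has_derivative
        (\<lambda>v. \<Sum>i\<in>UNIV. ?J (\<Phi> (E i)) v $ i)) (at ?y)"
      by (intro has_derivative_sum has_derivative_vec_nth J tensorial_smooth[OF \<Phi>] E)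
    then show "(vf_trace A \<Phi> \<circ> chart_inv ?c has_derivative (\<lambda>v. \<Sum>i\<in>UNIV. ?J (\<Phi> (E i)) v $ i)) (at ?y)"
      by (rule has_derivative_transform_within_open[OF _ U]) (use c tr in auto)
  qed
  let ?L = "endo_at A \<Phi> p"
  have L: "linear ?L" and JX: "linear (?J X)"
    using linear_endo_at[OF \<Phi>] has_derivative_linear[OF J[OF X]] by auto
  have "((\<lambda>y. axis i 1) has_derivative (\<lambda>v. 0)) (at ?y)" for i :: 'd
    by (rule has_derivative_const)
  then have "(?r (E i) has_derivative (\<lambda>v. 0)) (at ?y)" for i
    by (rule has_derivative_transform_within_open[OF _ U]) (use c dE in \<open>auto simp: vf_rep_chart\<close>)
  from frechet_derivative_eqI[OF this] have brE: "bracket A X (E i) p = - ?J X (axis i 1)" for i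
    by (simp add: bracket_def Let_def Ep)
  have "\<Phi> (bracket A X (E i)) p = - ?L (?J X (axis i 1))" for i
    using endo_at_eq[OF \<Phi> smooth_bracket[OF X E(5)] brE] linear_neg[OF L] by simp
  moreover have "bracket A X (\<Phi> (E i)) p = ?J (\<Phi> (E i)) (X p) - ?J X (?L (axis i 1))" for i
    using endo_at_eq[OF \<Phi> E(5) Ep] by (simp add: bracket_def Let_def)
  ultimately have "vf_trace A (\<lambda>Z q. bracket A X (\<Phi> Z) q - \<Phi> (bracket A X Z) q) p
      = (\<Sum>i\<in>UNIV. ?J (\<Phi> (E i)) (X p) $ i - ?J X (?L (axis i 1)) $ i + ?L (?J X (axis i 1)) $ i)"
    by (simp add: vf_trace_def trace_matrix
        endo_at_eq[OF tensorial_lie_derivative[OF \<Phi> X] E(5) Ep])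
  also have "\<dots> = (\<Sum>i\<in>UNIV. ?J (\<Phi> (E i)) (X p) $ i)"
    using trace_matrix_compose_commute[OF L JX]
    by (simp add: sum.distrib sum_subtractf trace_matrix)
  finally show ?thesis using lhs by simp
qed

lemma smooth_curvature:
  "smooth_vf A X \<Longrightarrow> smooth_vf A Y \<Longrightarrow> smooth_vf A Z \<Longrightarrow> smooth_vf A (curvature A D X Y Z)"
proof -
  assume *: "smooth_vf A X" "smooth_vf A Y" "smooth_vf A Z"
  have "curvature A D X Y Z = (\<lambda>p. D X (D Y Z) p - D Y (D X Z) p - D (bracket A X Y) Z p)"
    by (auto simp: curvature_def)
  then show ?thesis using * by (simp add: smooth_vf_diff smooth_D smooth_bracket)
qed

lemma tensorial_curvature:
  assumes X: "smooth_vf A X" and Y: "smooth_vf A Y"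
  shows "tensorial (curvature A D X Y)"
  unfolding tensorial_def
proof (intro conjI allI impI; (elim conjE)?)
  fix Z assume Z: "smooth_vf A Z"
  then show "smooth_vf A (curvature A D X Y Z)" by (intro smooth_curvature X Y)
next
  fix Z Z' p assume Z: "smooth_vf A Z" "smooth_vf A Z'"
  have "D X (\<lambda>q. Z q + Z' q) = (\<lambda>q. D X Z q + D X Z' q)" "D Y (\<lambda>q. Z q + Z' q) = (\<lambda>q. D Y Z q + D Y Z' q)"
    using Z X Y by (auto simp: D_add)
  then show "curvature A D X Y (\<lambda>q. Z q + Z' q) p = curvature A D X Y Z p + curvature A D X Y Z' p"
    using Z X Y by (simp add: curvature_def D_add smooth_D smooth_bracket)
next
  fix h Z p assume Z: "smooth_fun A h" "smooth_vf A Z"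
  have "D X (\<lambda>q. h q *\<^sub>R Z q) = (\<lambda>q. vf_app A X h q *\<^sub>R Z q + h q *\<^sub>R D X Z q)" if "smooth_vf A X" for X
    using Z that by (auto simp: D_scale)
  then show "curvature A D X Y (\<lambda>q. h q *\<^sub>R Z q) p = h p *\<^sub>R curvature A D X Y Z p"
    \<comment> \<open>The second derivatives of \<open>h\<close> leave the commutator of
      \<open>X\<close> and \<open>Y\<close>, which \<open>bracket_app\<close> cancels against the
      bracket term.\<close>
    using Z X Y by (simp add: curvature_def D_add D_scale smooth_D smooth_bracket smooth_vf_scale
        smooth_fun_vf_app bracket_app algebra_simps)
qed

section \<open>Lie derivatives of the metric, the connection and the curvature\<close>

lemma D_zero_left: "smooth_vf A Y \<Longrightarrow> D (\<lambda>q. 0) Y p = 0"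
  using D_scale_left[of "\<lambda>q. 0" "\<lambda>q. 0" Y p] by (simp add: smooth_fun_const smooth_vf_zero)

lemma bracket_zero: "smooth_vf A X \<Longrightarrow> bracket A X (\<lambda>q. 0) p = 0"
  by (simp add: bracket_eq smooth_vf_zero D_zero D_zero_left)

lemma bracket_diff:
  "smooth_vf A X \<Longrightarrow> smooth_vf A Y \<Longrightarrow> smooth_vf A Y' \<Longrightarrow>
    bracket A X (\<lambda>q. Y q - Y' q) p = bracket A X Y p - bracket A X Y' p"
  using bracket_add[of X Y "\<lambda>q. - 1 *\<^sub>R Y' q" p] bracket_scale[OF smooth_fun_const[of "- 1"], of X Y' p]
    smooth_vf_scale_const[of Y' "- 1"]
  by simp

text \<open>The Lie derivative of \<open>g\<close> along \<open>V\<close> in covariant form, in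
  which \<open>X\<close> and \<open>Y\<close> are not differentiated.\<close>

definition deform :: "('m, 'd) vfield \<Rightarrow> ('m, 'd) vfield \<Rightarrow> ('m, 'd) vfield \<Rightarrow> 'm \<Rightarrow> real" where
  "deform V X Y p = g p (D X V p) (Y p) + g p (X p) (D Y V p)"

lemma lie_deriv2_eq_deform:
  assumes "smooth_vf A V" "smooth_vf A X" "smooth_vf A Y"
  shows "lie_deriv2 A V g X Y p = deform V X Y p"
  using assms by (simp add: lie_deriv2_def deform_def metric_compatible bracket_eq metric_simps)

lemma smooth_deform:
  "smooth_vf A V \<Longrightarrow> smooth_vf A X \<Longrightarrow> smooth_vf A Y \<Longrightarrow> smooth_fun A (deform V X Y)"
  unfolding deform_def[abs_def] by (intro smooth_fun_add smooth_metric smooth_D)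

text \<open>The Lie derivative of the connection along \<open>N\<close>.\<close>

definition lie_D :: "('m, 'd) vfield \<Rightarrow> ('m, 'd) vfield \<Rightarrow> ('m, 'd) vfield \<Rightarrow> ('m, 'd) vfield" where
  "lie_D N X Y p = bracket A N (D X Y) p - D (bracket A N X) Y p - D X (bracket A N Y) p"

lemma smooth_lie_D:
  "smooth_vf A N \<Longrightarrow> smooth_vf A X \<Longrightarrow> smooth_vf A Y \<Longrightarrow> smooth_vf A (lie_D N X Y)"
  unfolding lie_D_def[abs_def] by (intro smooth_vf_diff smooth_D smooth_bracket)

lemma bracket_D:
  "bracket A N (D X Y) p = lie_D N X Y p + D (bracket A N X) Y p + D X (bracket A N Y) p"
  by (simp add: lie_D_def)

text \<open>The torsion vanishes and so does its Lie derivative, which is the Jacobi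
  identity.\<close>

lemma lie_D_sym:
  assumes N: "smooth_vf A N" and X: "smooth_vf A X" and Y: "smooth_vf A Y"
  shows "lie_D N X Y p = lie_D N Y X p"
proof -
  have "bracket A X Y = (\<lambda>q. D X Y q - D Y X q)"
    using X Y by (auto simp: bracket_eq)
  then have "bracket A N (D X Y) p - bracket A N (D Y X) p = bracket A N (bracket A X Y) p"
    using assms by (simp add: bracket_diff smooth_D)
  also have "\<dots> = bracket A (bracket A N X) Y p + bracket A X (bracket A N Y) p"
    by (rule jacobi[OF N X Y])
  finally show ?thesis
    using assms by (simp add: lie_D_def bracket_eq[of _ Y] bracket_eq[of X] smooth_bracket algebra_simps)
qed

text \<open>The Lie derivative of the curvature is the alternation in \<open>X\<close>,
  \<open>Y\<close> of the covariant derivative of \<open>lie_D N\<close>, here written out. It comes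
  from moving \<open>N\<close> past every \<open>D\<close> in the curvature.\<close>

lemma lie_curvature:
  assumes N: "smooth_vf A N" and X: "smooth_vf A X" and Y: "smooth_vf A Y" and Z: "smooth_vf A Z"
  shows "bracket A N (curvature A D X Y Z) p
      - curvature A D (bracket A N X) Y Z p - curvature A D X (bracket A N Y) Z p
      - curvature A D X Y (bracket A N Z) p
    = D X (lie_D N Y Z) p + lie_D N X (D Y Z) p - D Y (lie_D N X Z) p - lie_D N Y (D X Z) p
      - lie_D N (bracket A X Y) Z p"
proof -
  note sm = assms smooth_D smooth_bracket smooth_lie_D smooth_vf_add smooth_vf_diff
  have R: "curvature A D X Y Z = (\<lambda>q. D X (D Y Z) q - D Y (D X Z) q - D (bracket A X Y) Z q)"
    by (auto simp: curvature_def)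
  have br: "bracket A N (D X Z) = (\<lambda>q. lie_D N X Z q + D (bracket A N X) Z q + D X (bracket A N Z) q)" for X
    by (auto simp: bracket_D)
  have DD: "bracket A N (D X (D Y Z)) p = lie_D N X (D Y Z) p + D (bracket A N X) (D Y Z) p
      + D X (lie_D N Y Z) p + D X (D (bracket A N Y) Z) p + D X (D Y (bracket A N Z)) p"
    if "smooth_vf A X" "smooth_vf A Y" for X Y
    by (subst bracket_D) (simp add: br D_add sm that)
  have "bracket A N (bracket A X Y) = (\<lambda>q. bracket A (bracket A N X) Y q + bracket A X (bracket A N Y) q)"
    using jacobi[OF N X Y] by auto
  then have B: "bracket A N (D (bracket A X Y) Z) p = lie_D N (bracket A X Y) Z p
      + D (bracket A (bracket A N X) Y) Z p + D (bracket A X (bracket A N Y)) Z p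
      + D (bracket A X Y) (bracket A N Z) p"
    by (subst bracket_D) (simp add: D_add_left sm)
  have "bracket A N (curvature A D X Y Z) p = bracket A N (D X (D Y Z)) p - bracket A N (D Y (D X Z)) p
      - bracket A N (D (bracket A X Y) Z) p"
    unfolding R by (simp add: bracket_diff sm)
  then show ?thesis
    by (simp add: DD[OF X Y] DD[OF Y X] B curvature_def)
qed

end

subsection \<open>Weak \<open>\<beta>f\<close>-Kenmotsu manifolds\<close>

locale weak_kenmotsu = riemannian_manifold A g D
  for A :: "('m::{t2_space,second_countable_topology}, 'd::finite) chart set" and g D +
  fixes n s :: nat and f Q :: "('m, 'd) endo"
    and \<xi> :: "nat \<Rightarrow> ('m, 'd) vfield" and \<eta> :: "nat \<Rightarrow> ('m, 'd) form1" and \<beta> :: real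
  assumes kenmotsu: "weak_beta_f_kenmotsu A n s f Q \<xi> \<eta> g D \<beta>"
begin

text \<open>Keeps the index set \<open>{1..s}\<close> in the form in which the rules state
  it.\<close>

declare One_nat_def [simp del]

lemma f_structure: "weak_metric_f_structure A n s f Q \<xi> \<eta> g"
  using kenmotsu by (simp add: weak_beta_f_kenmotsu_def)

lemma
  shows n_pos: "n > 0" and s_pos: "s > 0"
    and tensor_f: "tensor11 A f" and tensor_Q: "tensor11 A Q"
    and f_skew: "g p (f p x) y = - g p x (f p y)"
    and dim_range_f: "dim (range (f p)) = 2 * n"
    and bij_Q: "bij (Q p)"
    and smooth_xi: "i \<in> {1..s} \<Longrightarrow> smooth_vf A (\<xi> i)"
    and one_form_eta: "i \<in> {1..s} \<Longrightarrow> one_form A (\<eta> i)"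
    and xi_orthonormal: "i \<in> {1..s} \<Longrightarrow> j \<in> {1..s} \<Longrightarrow> g p (\<xi> i p) (\<xi> j p) = (if i = j then 1 else 0)"
    and f_f: "f p (f p x) = - Q p x + (\<Sum>i\<in>{1..s}. \<eta> i p x *\<^sub>R \<xi> i p)"
    and eta_xi: "i \<in> {1..s} \<Longrightarrow> j \<in> {1..s} \<Longrightarrow> \<eta> i p (\<xi> j p) = (if i = j then 1 else 0)"
    and Q_xi: "i \<in> {1..s} \<Longrightarrow> Q p (\<xi> i p) = \<xi> i p"
    and metric_f_f: "g p (f p x) (f p y) = g p x (Q p y) - (\<Sum>i\<in>{1..s}. \<eta> i p x * \<eta> i p y)"
  using f_structure unfolding weak_metric_f_structure_def by auto

lemma linear_f: "linear (f p)" and smooth_f: "smooth_vf A X \<Longrightarrow> smooth_vf A (\<lambda>p. f p (X p))"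
  using tensor_f by (auto simp: tensor11_def)

lemma linear_Q: "linear (Q p)"
  using tensor_Q by (auto simp: tensor11_def)

lemma linear_eta: "i \<in> {1..s} \<Longrightarrow> linear (\<eta> i p)"
  and smooth_eta: "i \<in> {1..s} \<Longrightarrow> smooth_vf A X \<Longrightarrow> smooth_fun A (\<lambda>p. \<eta> i p (X p))"
  using one_form_eta by (auto simp: one_form_def)

lemmas f_simps = linear_add[OF linear_f] linear_diff[OF linear_f] linear_0[OF linear_f]
  linear_neg[OF linear_f] linear.scaleR[OF linear_f]

text \<open>The squared length of f \<xi> is g(\<xi>, Q \<xi>) - 1 = 0.\<close>

lemma f_xi: "i \<in> {1..s} \<Longrightarrow> f p (\<xi> i p) = 0"
proof (rule ccontr)
  assume i: "i \<in> {1..s}" and "f p (\<xi> i p) \<noteq> 0"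
  then have "g p (f p (\<xi> i p)) (f p (\<xi> i p)) > 0" by (intro metric_pos)
  moreover have "(\<Sum>j\<in>{1..s}. \<eta> j p (\<xi> i p) * \<eta> j p (\<xi> i p)) = (\<Sum>j\<in>{1..s}. if j = i then 1 else 0)"
    using i by (intro sum.cong) (auto simp: eta_xi)
  ultimately show False using i by (simp add: metric_f_f Q_xi xi_orthonormal)
qed

text \<open>The compatibility of \<open>f\<close> and \<open>g\<close> with a \<xi> in the second
  slot, where its left side vanishes.\<close>

lemma eta_eq_metric: "i \<in> {1..s} \<Longrightarrow> \<eta> i p x = g p x (\<xi> i p)"
proof -
  assume i: "i \<in> {1..s}"
  have "(\<Sum>j\<in>{1..s}. \<eta> j p x * \<eta> j p (\<xi> i p)) = (\<Sum>j\<in>{1..s}. if j = i then \<eta> i p x else 0)"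
    using i by (intro sum.cong) (auto simp: eta_xi)
  then show ?thesis
    using i metric_f_f[of p x "\<xi> i p"] by (simp add: f_xi metric_simps Q_xi)
qed

lemma eta_f: "i \<in> {1..s} \<Longrightarrow> \<eta> i p (f p x) = 0"
  by (simp add: eta_eq_metric f_skew f_xi metric_simps)

section \<open>Transverse projection and transverse metric\<close>

definition proj :: "'m \<Rightarrow> real ^ 'd \<Rightarrow> real ^ 'd" where
  "proj p x = x - (\<Sum>i\<in>{1..s}. \<eta> i p x *\<^sub>R \<xi> i p)"

text \<open>The \<gamma> of the overview, extended by zero to the span of the \<xi>'s.\<close>

definition tmetric :: "'m \<Rightarrow> real ^ 'd \<Rightarrow> real ^ 'd \<Rightarrow> real" where
  "tmetric p x y = g p x y - (\<Sum>i\<in>{1..s}. \<eta> i p x * \<eta> i p y)"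

lemma metric_proj: "g p (proj p x) y = tmetric p x y" "g p x (proj p y) = tmetric p x y"
  by (simp_all add: proj_def tmetric_def metric_simps metric_sum_left metric_sum_right
      eta_eq_metric[of _ p y] eta_eq_metric[of _ p x] metric_sym[of p "\<xi> _ p"] mult.commute)

lemma tmetric_sym: "tmetric p x y = tmetric p y x"
  by (simp add: tmetric_def metric_sym[of p x] mult.commute)

lemma tmetric_simps:
  "tmetric p (x + y) z = tmetric p x z + tmetric p y z" "tmetric p (x - y) z = tmetric p x z - tmetric p y z"
  "tmetric p (r *\<^sub>R x) z = r * tmetric p x z" "tmetric p 0 z = 0"
  "tmetric p z (x + y) = tmetric p z x + tmetric p z y" "tmetric p z (x - y) = tmetric p z x - tmetric p z y"
  "tmetric p z (r *\<^sub>R x) = r * tmetric p z x" "tmetric p z 0 = 0"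
  by (simp_all only: metric_proj(2)[symmetric, of p _ z] metric_proj(1)[symmetric, of p z] metric_simps)

lemma tmetric_f: "tmetric p (f p x) y = g p (f p x) y" "tmetric p y (f p x) = g p y (f p x)"
  by (simp_all add: tmetric_def eta_f)

lemma proj_f: "proj p (f p x) = f p x"
  by (simp add: proj_def eta_f)

lemma f_sum: "f p (\<Sum>i\<in>I. x i) = (\<Sum>i\<in>I. f p (x i))"
  by (rule linear_sum[OF linear_f])

lemma f_proj: "f p (proj p x) = f p x"
  by (simp add: proj_def f_simps f_sum f_xi)

lemma proj_xi: "i \<in> {1..s} \<Longrightarrow> proj p (\<xi> i p) = 0"
proof -
  assume i: "i \<in> {1..s}"
  have "(\<Sum>j\<in>{1..s}. \<eta> j p (\<xi> i p) *\<^sub>R \<xi> j p) = (\<Sum>j\<in>{1..s}. if j = i then \<xi> i p else 0)"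
    using i by (intro sum.cong) (auto simp: eta_xi)
  then show ?thesis using i by (simp add: proj_def)
qed

text \<open>If f x = 0, then \<open>Q\<close> takes the same value at \<open>x\<close> and at its
  component in the span of the \<xi>'s, and \<open>Q\<close> is injective. This turns identities
  under \<open>f\<close> into identities of projections.\<close>

lemma f_kernel:
  assumes "f p x = 0"
  shows "proj p x = 0"
proof -
  have "Q p x = (\<Sum>i\<in>{1..s}. \<eta> i p x *\<^sub>R \<xi> i p)"
    using f_f[of p x] assms by (simp add: f_simps)
  also have "\<dots> = Q p (\<Sum>i\<in>{1..s}. \<eta> i p x *\<^sub>R \<xi> i p)"
    by (simp add: linear_sum[OF linear_Q] linear.scaleR[OF linear_Q] Q_xi)
  finally show ?thesis
    using bij_Q[of p] unfolding proj_def by (simp add: bij_def inj_eq)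
qed

lemma tmetric_proj: "tmetric p (proj p x) y = tmetric p x y" "tmetric p y (proj p x) = tmetric p y x"
proof -
  have "proj p (proj p x - x) = 0"
    by (rule f_kernel) (simp add: f_simps f_proj)
  then have "tmetric p (proj p x - x) y = 0"
    using metric_proj(1)[of p "proj p x - x" y] by (simp add: metric_simps)
  then show "tmetric p (proj p x) y = tmetric p x y" "tmetric p y (proj p x) = tmetric p y x"
    by (simp_all add: tmetric_simps tmetric_sym[of p y])
qed

section \<open>Covariant derivatives of the structure fields\<close>

lemma cov_deriv_f:
  "smooth_vf A X \<Longrightarrow> smooth_vf A Y \<Longrightarrow>
    D X (\<lambda>q. f q (Y q)) p = f p (D X Y p) +
      \<beta> *\<^sub>R (g p (f p (X p)) (Y p) *\<^sub>R xi_bar s \<xi> p - eta_bar s \<eta> p (Y p) *\<^sub>R f p (X p))"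
  using kenmotsu by (simp add: weak_beta_f_kenmotsu_def cov_deriv11_def algebra_simps)

text \<open>Differentiate f \<xi> = 0 and insert the Kenmotsu condition.\<close>

lemma D_xi_f:
  assumes X: "smooth_vf A X" and i: "i \<in> {1..s}"
  shows "f p (D X (\<xi> i) p) = \<beta> *\<^sub>R f p (X p)"
proof -
  have "(\<lambda>q. f q (\<xi> i q)) = (\<lambda>q. 0)" using i by (simp add: f_xi)
  moreover have "eta_bar s \<eta> p (\<xi> i p) = 1"
    using i by (simp add: eta_bar_def eta_xi)
  moreover have "g p (f p (X p)) (\<xi> i p) = 0"
    using eta_f[OF i] eta_eq_metric[OF i] by simp
  ultimately show ?thesis
    using cov_deriv_f[OF X smooth_xi[OF i], of p] X by (simp add: D_zero)
qed

lemma D_xi_skew: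
  assumes X: "smooth_vf A X" and i: "i \<in> {1..s}" and j: "j \<in> {1..s}"
  shows "g p (D X (\<xi> i) p) (\<xi> j p) = - g p (D X (\<xi> j) p) (\<xi> i p)"
proof -
  have "(\<lambda>q. g q (\<xi> i q) (\<xi> j q)) = (\<lambda>q. if i = j then 1 else 0)"
    using i j by (simp add: xi_orthonormal)
  then show ?thesis
    using metric_compatible[OF X smooth_xi[OF i] smooth_xi[OF j], of p] metric_sym[of p "\<xi> i p"] by simp
qed

text \<open>Since f \<xi> = 0, every term of the Nijenhuis tensor at (X, \<xi>) is zero or in the
  image of \<open>f\<close>, which each \<eta> kills. So normality leaves d\<eta>(X, \<xi>) = 0, and
  this is rewritten with the connection.\<close>

lemma normality:
  assumes X: "smooth_vf A X" and j: "j \<in> {1..s}" and k: "k \<in> {1..s}"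
  shows "g p (D X (\<xi> k) p) (\<xi> j p) = g p (X p) (D (\<xi> j) (\<xi> k) p)"
proof -
  have f0: "(\<lambda>q. f q (\<xi> j q)) = (\<lambda>q. 0)" using j by (simp add: f_xi)
  have "normal_structure A s f \<xi> \<eta>" using kenmotsu by (simp add: weak_beta_f_kenmotsu_def)
  then have "nijenhuis A f X (\<xi> j) p
      + 2 *\<^sub>R (\<Sum>i\<in>{1..s}. ext_deriv A (\<eta> i) X (\<xi> j) p *\<^sub>R \<xi> i p) = 0"
    using X j smooth_xi unfolding normal_structure_def by blast
  then have "\<eta> k p (nijenhuis A f X (\<xi> j) p
      + 2 *\<^sub>R (\<Sum>i\<in>{1..s}. ext_deriv A (\<eta> i) X (\<xi> j) p *\<^sub>R \<xi> i p)) = 0"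
    using linear_0[OF linear_eta[OF k]] by simp
  moreover have "\<eta> k p (nijenhuis A f X (\<xi> j) p) = 0"
    using X j k unfolding nijenhuis_def f0
    by (simp add: linear_add[OF linear_eta[OF k]] linear_diff[OF linear_eta[OF k]] eta_f bracket_zero
        smooth_f linear_0[OF linear_eta[OF k]])
  moreover have "\<eta> k p (2 *\<^sub>R (\<Sum>i\<in>{1..s}. ext_deriv A (\<eta> i) X (\<xi> j) p *\<^sub>R \<xi> i p))
      = 2 * (\<Sum>i\<in>{1..s}. if i = k then ext_deriv A (\<eta> k) X (\<xi> j) p else 0)"
    using k by (simp add: linear.scaleR[OF linear_eta[OF k]] linear_sum[OF linear_eta[OF k]] eta_xi
        if_distrib cong: if_cong)
  ultimately have "ext_deriv A (\<eta> k) X (\<xi> j) p = 0"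
    using k linear_add[OF linear_eta[OF k]] by simp
  moreover have "(\<lambda>q. \<eta> k q (\<xi> j q)) = (\<lambda>q. if k = j then 1 else 0)"
    using j k by (simp add: eta_xi)
  ultimately have "vf_app A (\<xi> j) (\<lambda>q. g q (X q) (\<xi> k q)) p + g p (bracket A X (\<xi> j) p) (\<xi> k p) = 0"
    using k by (simp add: ext_deriv_def eta_eq_metric)
  then have "g p (X p) (D (\<xi> j) (\<xi> k) p) + g p (D X (\<xi> j) p) (\<xi> k p) = 0"
    using X j k by (simp add: metric_compatible smooth_xi bracket_eq metric_simps)
  then show ?thesis using D_xi_skew[OF X k j] by simp
qed

lemma D_xi_expand:
  assumes X: "smooth_vf A X" and i: "i \<in> {1..s}"
  shows "D X (\<xi> i) p = \<beta> *\<^sub>R proj p (X p) + (\<Sum>j\<in>{1..s}. g p (D X (\<xi> i) p) (\<xi> j p) *\<^sub>R \<xi> j p)"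
proof -
  have "proj p (D X (\<xi> i) p - \<beta> *\<^sub>R X p) = 0"
    by (rule f_kernel) (simp add: f_simps D_xi_f[OF X i])
  moreover have "proj p (x - r *\<^sub>R y) = proj p x - r *\<^sub>R proj p y" for x y r
    by (rule metric_eqI[where p = p]) (simp add: metric_simps metric_proj tmetric_simps)
  ultimately have "proj p (D X (\<xi> i) p) = \<beta> *\<^sub>R proj p (X p)" by simp
  then show ?thesis
    by (subst (asm) (1) proj_def) (simp add: eta_eq_metric algebra_simps)
qed

text \<open>The normal coefficients in \<open>D_xi_expand\<close> vanish first along the \<xi>'s, by
  the symmetry argument that also makes the Levi-Civita connection unique; \<open>normality\<close>
  then carries this over to every \<open>X\<close>.\<close>

lemma D_xi:
  assumes X: "smooth_vf A X" and i: "i \<in> {1..s}"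
  shows "D X (\<xi> i) p = \<beta> *\<^sub>R proj p (X p)"
proof -
  let ?c = "\<lambda>k j l. g p (D (\<xi> l) (\<xi> k) p) (\<xi> j p)"
  have c1: "?c k j l = - ?c j k l" and c2: "?c k j l = ?c k l j"
    if "j \<in> {1..s}" "k \<in> {1..s}" "l \<in> {1..s}" for j k l
    using D_xi_skew[OF smooth_xi, of l k j p] normality[OF smooth_xi, of l j k p] metric_sym that by auto
  \<comment> \<open>Skew in the first two and symmetric in the last two indices.\<close>
  have c0: "?c k j l = 0" if "j \<in> {1..s}" "k \<in> {1..s}" "l \<in> {1..s}" for j k l
    using c1[of j k l] c2[of k j l] c1[of l j k] c2[of j l k] c1[of k l j] c2[of j k l] that by linarith
  have "D (\<xi> j) (\<xi> i) p = 0" if j: "j \<in> {1..s}" for j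
    using D_xi_expand[OF smooth_xi[OF j] i, of p] c0[OF _ i j] j by (simp add: proj_xi)
  then have "g p (D X (\<xi> i) p) (\<xi> j p) = 0" if j: "j \<in> {1..s}" for j
    using normality[OF X j i, of p] j by (simp add: metric_simps)
  then show ?thesis using D_xi_expand[OF X i, of p] by simp
qed

lemma deriv_eta:
  assumes "smooth_vf A X" "smooth_vf A Y" and i: "i \<in> {1..s}"
  shows "vf_app A X (\<lambda>q. \<eta> i q (Y q)) p = \<beta> * tmetric p (X p) (Y p) + \<eta> i p (D X Y p)"
  using assms tmetric_sym[of p "Y p"]
  by (simp add: eta_eq_metric metric_compatible smooth_xi D_xi metric_simps metric_proj)

abbreviation "K \<equiv> real s * \<beta>"
abbreviation "xb \<equiv> xi_bar s \<xi>"
abbreviation "et \<equiv> eta_bar s \<eta>"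

lemma smooth_xb: "smooth_vf A xb"
  unfolding xi_bar_def[abs_def] by (intro smooth_vf_sum smooth_xi)

lemma f_xb: "f p (xb p) = 0"
  by (simp add: xi_bar_def f_sum f_xi)

lemma et_eq_metric: "et p x = g p x (xb p)"
  by (simp add: eta_bar_def xi_bar_def metric_sum_right eta_eq_metric)

lemma et_simps: "et p (x + y) = et p x + et p y" "et p (x - y) = et p x - et p y"
  "et p (r *\<^sub>R x) = r * et p x" "et p 0 = 0" "et p (f p x) = 0"
  by (simp_all add: et_eq_metric metric_simps f_skew f_xb)

lemma smooth_et: "smooth_vf A X \<Longrightarrow> smooth_fun A (\<lambda>p. et p (X p))"
  by (simp add: et_eq_metric smooth_metric smooth_xb)

lemma tmetric_xb: "tmetric p (xb p) y = 0" "tmetric p y (xb p) = 0"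
  using metric_proj[of p "xb p" y] metric_proj[of p y "xb p"] f_kernel[OF f_xb]
  by (simp_all add: metric_simps)

lemma et_xb: "et p (xb p) = real s"
  by (simp add: eta_bar_def xi_bar_def linear_sum[OF linear_eta] eta_xi)

lemma smooth_tmetric: "smooth_vf A X \<Longrightarrow> smooth_vf A Y \<Longrightarrow> smooth_fun A (\<lambda>p. tmetric p (X p) (Y p))"
  unfolding tmetric_def by (intro smooth_fun_diff smooth_fun_sum smooth_fun_mult smooth_metric smooth_eta)

lemma D_xb:
  assumes "smooth_vf A X"
  shows "D X xb p = K *\<^sub>R proj p (X p)"
proof -
  have "D X xb p = (\<Sum>i\<in>{1..s}. D X (\<xi> i) p)"
    unfolding xi_bar_def[abs_def] by (rule D_sum[OF assms smooth_xi])
  also have "\<dots> = (\<Sum>i\<in>{1..s}. \<beta> *\<^sub>R proj p (X p))"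
    by (rule sum.cong[OF refl D_xi[OF assms]])
  also have "\<dots> = K *\<^sub>R proj p (X p)"
    by (simp add: sum_constant_scaleR del: sum_constant)
  finally show ?thesis .
qed

lemma D_along_xb: "smooth_vf A X \<Longrightarrow> D xb X p = bracket A xb X p + K *\<^sub>R proj p (X p)"
  by (simp add: bracket_eq smooth_xb D_xb)

text \<open>\<open>tmetric\<close> is not parallel: the last line is its covariant derivative,
  coming from \<open>deriv_eta\<close> and summed over the index into \<open>et\<close>.\<close>

lemma deriv_tmetric:
  assumes "smooth_vf A X" "smooth_vf A Y" "smooth_vf A Z"
  shows "vf_app A X (\<lambda>q. tmetric q (Y q) (Z q)) p
    = tmetric p (D X Y p) (Z p) + tmetric p (Y p) (D X Z p)
      - \<beta> * (tmetric p (X p) (Y p) * et p (Z p) + tmetric p (X p) (Z p) * et p (Y p))"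
proof -
  have "vf_app A X (\<lambda>q. tmetric q (Y q) (Z q)) p = vf_app A X (\<lambda>q. g q (Y q) (Z q)) p
    - (\<Sum>i\<in>{1..s}. vf_app A X (\<lambda>q. \<eta> i q (Y q)) p * \<eta> i p (Z p) + \<eta> i p (Y p) * vf_app A X (\<lambda>q. \<eta> i q (Z q)) p)"
  proof -
    have sm: "smooth_fun A (\<lambda>q. \<eta> i q (Y q) * \<eta> i q (Z q))" if "i \<in> {1..s}" for i
      by (intro smooth_fun_mult smooth_eta assms that)
    have "vf_app A X (\<lambda>q. \<eta> i q (Y q) * \<eta> i q (Z q)) p
      = vf_app A X (\<lambda>q. \<eta> i q (Y q)) p * \<eta> i p (Z p) + \<eta> i p (Y p) * vf_app A X (\<lambda>q. \<eta> i q (Z q)) p"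
      if "i \<in> {1..s}" for i
      by (intro vf_app_mult smooth_eta assms that)
    then have "vf_app A X (\<lambda>q. \<Sum>i\<in>{1..s}. \<eta> i q (Y q) * \<eta> i q (Z q)) p
      = (\<Sum>i\<in>{1..s}. vf_app A X (\<lambda>q. \<eta> i q (Y q)) p * \<eta> i p (Z p) + \<eta> i p (Y p) * vf_app A X (\<lambda>q. \<eta> i q (Z q)) p)"
      by (subst vf_app_sum) (auto intro!: sm sum.cong)
    then show ?thesis
      unfolding tmetric_def
      by (subst vf_app_diff[OF smooth_metric[OF assms(2,3)] smooth_fun_sum]) (auto intro: sm)
  qed
  also have "\<dots> = tmetric p (D X Y p) (Z p) + tmetric p (Y p) (D X Z p)
      - \<beta> * (tmetric p (X p) (Y p) * et p (Z p) + tmetric p (X p) (Z p) * et p (Y p))"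
    using assms by (simp add: deriv_eta metric_compatible tmetric_def[of p "D X Y p"] tmetric_def[of p "Y p" "D X Z p"]
        eta_bar_def sum.distrib sum_distrib_left sum_distrib_right algebra_simps)
  finally show ?thesis .
qed

section \<open>Lie derivatives along \<open>xb\<close>\<close>

lemma lie_metric:
  assumes "smooth_vf A X" "smooth_vf A Y"
  shows "vf_app A xb (\<lambda>q. g q (X q) (Y q)) p
    = g p (bracket A xb X p) (Y p) + g p (X p) (bracket A xb Y p) + 2 * K * tmetric p (X p) (Y p)"
  using assms by (simp add: metric_compatible smooth_xb D_along_xb metric_simps metric_proj)

lemma lie_et:
  assumes "smooth_vf A X"
  shows "vf_app A xb (\<lambda>q. et q (X q)) p = et p (bracket A xb X p)"
proof -
  have "bracket A xb xb p = 0" by (simp add: bracket_eq smooth_xb)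
  then show ?thesis
    using lie_metric[OF assms smooth_xb] by (simp add: et_eq_metric tmetric_xb metric_simps)
qed

lemma lie_tmetric:
  assumes "smooth_vf A X" "smooth_vf A Y"
  shows "vf_app A xb (\<lambda>q. tmetric q (X q) (Y q)) p
    = tmetric p (bracket A xb X p) (Y p) + tmetric p (X p) (bracket A xb Y p) + 2 * K * tmetric p (X p) (Y p)"
  using assms by (simp add: deriv_tmetric smooth_xb D_along_xb tmetric_simps tmetric_xb tmetric_proj)

text \<open>As f xb = 0 and \<open>et\<close> vanishes on the image of \<open>f\<close>, no Kenmotsu
  correction survives that could disturb the cancellation of the two terms K f X.\<close>

lemma lie_f: "smooth_vf A X \<Longrightarrow> bracket A xb (\<lambda>q. f q (X q)) p = f p (bracket A xb X p)"
  by (simp add: bracket_eq smooth_xb smooth_f D_xb cov_deriv_f f_xb f_simps f_proj proj_f metric_simps)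

text \<open>Apply the commutator of \<open>xb\<close> and \<open>X\<close> to g(Y, Z). As the Lie
  derivative of \<open>g\<close> is 2 K \<open>tmetric\<close>, the result is 2 K times the
  covariant derivative of \<open>tmetric\<close>.\<close>

lemma lie_D_xb_metric:
  assumes X: "smooth_vf A X" and Y: "smooth_vf A Y" and Z: "smooth_vf A Z"
  shows "g p (lie_D xb X Y p) (Z p) + g p (Y p) (lie_D xb X Z p)
    = - 2 * K * \<beta> * (tmetric p (X p) (Y p) * et p (Z p) + tmetric p (X p) (Z p) * et p (Y p))"
proof -
  note sm = X Y Z smooth_xb smooth_D smooth_bracket smooth_metric smooth_tmetric smooth_fun_add
  let ?h = "\<lambda>q. g q (Y q) (Z q)"
  have 1: "vf_app A X ?h = (\<lambda>q. g q (D X Y q) (Z q) + g q (Y q) (D X Z q))"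
    by (auto simp: metric_compatible sm)
  have 2: "vf_app A xb ?h = (\<lambda>q. g q (bracket A xb Y q) (Z q) + g q (Y q) (bracket A xb Z q)
      + 2 * K * tmetric q (Y q) (Z q))"
    by (auto simp: lie_metric sm)
  have "vf_app A xb (vf_app A X ?h) p - vf_app A X (vf_app A xb ?h) p = vf_app A (bracket A xb X) ?h p"
    by (simp add: bracket_app sm)
  moreover have "vf_app A xb (vf_app A X ?h) p
      = g p (bracket A xb (D X Y) p) (Z p) + g p (D X Y p) (bracket A xb Z p)
      + 2 * K * tmetric p (D X Y p) (Z p)
      + (g p (bracket A xb Y p) (D X Z p) + g p (Y p) (bracket A xb (D X Z) p)
      + 2 * K * tmetric p (Y p) (D X Z p))"
    unfolding 1 by (simp add: vf_app_add lie_metric sm)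
  moreover have "vf_app A X (vf_app A xb ?h) p
      = g p (D X (bracket A xb Y) p) (Z p) + g p (bracket A xb Y p) (D X Z p)
      + (g p (D X Y p) (bracket A xb Z p) + g p (Y p) (D X (bracket A xb Z) p))
      + 2 * K * (tmetric p (D X Y p) (Z p) + tmetric p (Y p) (D X Z p)
        - \<beta> * (tmetric p (X p) (Y p) * et p (Z p) + tmetric p (X p) (Z p) * et p (Y p)))"
    unfolding 2
    by (simp add: vf_app_add vf_app_cmult metric_compatible deriv_tmetric smooth_fun_mult smooth_fun_const sm)
  moreover have "vf_app A (bracket A xb X) ?h p
      = g p (D (bracket A xb X) Y p) (Z p) + g p (Y p) (D (bracket A xb X) Z p)"
    by (simp add: metric_compatible sm)
  ultimately show ?thesis
    by (simp add: lie_D_def metric_simps algebra_simps)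
qed

lemma lie_D_xb:
  assumes X: "smooth_vf A X" and Y: "smooth_vf A Y"
  shows "lie_D xb X Y p = (- 2 * K * \<beta> * tmetric p (X p) (Y p)) *\<^sub>R xb p"
proof (rule metric_eqI)
  fix z
  obtain Z where Z: "smooth_vf A Z" "Z p = z" using extension_exists by blast
  have sym: "lie_D xb Y X p = lie_D xb X Y p" "lie_D xb Z X p = lie_D xb X Z p" "lie_D xb Z Y p = lie_D xb Y Z p"
    by (rule lie_D_sym[OF smooth_xb]; fact X Y Z)+
  have tsym: "tmetric p (Y p) (X p) = tmetric p (X p) (Y p)" "tmetric p (Z p) (X p) = tmetric p (X p) (Z p)"
    "tmetric p (Z p) (Y p) = tmetric p (Y p) (Z p)" "g p (Y p) (lie_D xb X Z p) = g p (lie_D xb X Z p) (Y p)"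
    by (rule tmetric_sym metric_sym)+
  \<comment> \<open>The Koszul combination: adding two permutations of
    \<open>lie_D_xb_metric\<close> and subtracting the third isolates one term, because
    \<open>lie_D\<close> is symmetric.\<close>
  have "2 * g p (lie_D xb X Y p) (Z p) = 2 * (- 2 * K * \<beta> * tmetric p (X p) (Y p) * et p (Z p))"
    using lie_D_xb_metric[OF X Y Z(1), of p] lie_D_xb_metric[OF Y X Z(1), of p]
      lie_D_xb_metric[OF Z(1) X Y, of p]
    unfolding sym tsym by (simp only: ring_distribs)
  then show "g p (lie_D xb X Y p) z = g p ((- 2 * K * \<beta> * tmetric p (X p) (Y p)) *\<^sub>R xb p) z"
    using Z(2) by (simp add: et_eq_metric metric_simps metric_sym[of p z])
qed

lemma deriv_lie_D_xb:
  assumes "smooth_vf A X" "smooth_vf A Y" "smooth_vf A Z"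
  shows "D X (lie_D xb Y Z) p = (- 2 * K * \<beta>) *\<^sub>R
    ((tmetric p (D X Y p) (Z p) + tmetric p (Y p) (D X Z p)
      - \<beta> * (tmetric p (X p) (Y p) * et p (Z p) + tmetric p (X p) (Z p) * et p (Y p))) *\<^sub>R xb p
     + (K * tmetric p (Y p) (Z p)) *\<^sub>R proj p (X p))"
proof -
  have "lie_D xb Y Z = (\<lambda>q. (- 2 * K * \<beta>) *\<^sub>R (tmetric q (Y q) (Z q) *\<^sub>R xb q))"
    using lie_D_xb[OF assms(2,3)] by auto
  then have "D X (lie_D xb Y Z) p = (- 2 * K * \<beta>) *\<^sub>R D X (\<lambda>q. tmetric q (Y q) (Z q) *\<^sub>R xb q) p"
    by (simp only: D_cscale[OF assms(1) smooth_vf_scale[OF smooth_tmetric[OF assms(2,3)] smooth_xb]])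
  then show ?thesis
    using assms by (simp only: D_scale smooth_tmetric smooth_xb deriv_tmetric D_xb scaleR_scaleR mult.commute[of K])
qed

text \<open>The alternation removes all derivatives of \<open>X\<close>, \<open>Y\<close>,
  \<open>Z\<close>. The covariant derivative of \<open>tmetric\<close> leaves the part along
  \<open>xb\<close>, and the derivative of \<open>xb\<close> leaves the projections.\<close>

lemma lie_curvature_xb:
  assumes X: "smooth_vf A X" and Y: "smooth_vf A Y" and Z: "smooth_vf A Z"
  shows "bracket A xb (curvature A D X Y Z) p
      - curvature A D (bracket A xb X) Y Z p - curvature A D X (bracket A xb Y) Z p
      - curvature A D X Y (bracket A xb Z) p
    = (- 2 * K * \<beta>) *\<^sub>R
      ((\<beta> * (tmetric p (Y p) (Z p) * et p (X p) - tmetric p (X p) (Z p) * et p (Y p))) *\<^sub>R xb p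
       + (K * tmetric p (Y p) (Z p)) *\<^sub>R proj p (X p) - (K * tmetric p (X p) (Z p)) *\<^sub>R proj p (Y p))"
proof -
  have br: "bracket A X Y p = D X Y p - D Y X p" by (rule bracket_eq[OF X Y])
  show ?thesis
    unfolding lie_curvature[OF smooth_xb X Y Z] deriv_lie_D_xb[OF X Y Z] deriv_lie_D_xb[OF Y X Z]
      lie_D_xb[OF X smooth_D[OF Y Z]] lie_D_xb[OF Y smooth_D[OF X Z]] lie_D_xb[OF smooth_bracket[OF X Y] Z]
      br tmetric_simps tmetric_sym[of p "Y p" "X p"]
    by (simp add: algebra_simps)
qed

subsection \<open>The star Ricci tensor\<close>

abbreviation star_curv ::
  "('m, 'd) vfield \<Rightarrow> ('m, 'd) vfield \<Rightarrow> ('m, 'd) vfield \<Rightarrow> ('m, 'd) vfield" where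
  "star_curv X Y Z \<equiv> curvature A D X (\<lambda>q. f q (Y q)) (\<lambda>q. f q (Z q))"

lemma tensorial_star_curv:
  assumes "smooth_vf A X" "smooth_vf A Y"
  shows "tensorial (star_curv X Y)"
  using tensorialD[OF tensorial_curvature[OF assms(1) smooth_f[OF assms(2)]]]
  unfolding tensorial_def by (simp add: f_simps smooth_f)

text \<open>\<open>f\<close> is invariant along \<open>xb\<close>, so only the curvature
  contributes, by two maps of rank one in \<open>Z\<close> with equal traces. The constant 4 is
  twice that of the star Ricci tensor, which is half of this trace.\<close>

lemma lie_star_curv_trace:
  assumes X: "smooth_vf A X" and Y: "smooth_vf A Y"
  shows "vf_app A xb (vf_trace A (star_curv X Y)) p
    = vf_trace A (star_curv (bracket A xb X) Y) p + vf_trace A (star_curv X (bracket A xb Y)) p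
      - 4 * K\<^sup>2 * \<beta> * g p (f p (X p)) (f p (Y p))"
proof -
  \<comment> \<open>The vectors in \<open>lie_curvature_xb\<close> that multiply g(f Y, f Z) and
    g(X, f Z) when f Y and f Z are inserted; the term with et(f Y) is zero.\<close>
  define v where "v q = (- 2 * K * \<beta>) *\<^sub>R ((\<beta> * et q (X q)) *\<^sub>R xb q + K *\<^sub>R proj q (X q))" for q
  define w where "w q = (2 * K\<^sup>2 * \<beta>) *\<^sub>R f q (Y q)" for q
  have fbr: "bracket A xb (\<lambda>q. f q (Z q)) = (\<lambda>q. f q (bracket A xb Z q))" if "smooth_vf A Z" for Z
    using lie_f[OF that] by auto
  have "vf_app A xb (vf_trace A (star_curv X Y)) p
    = vf_trace A (\<lambda>Z q. bracket A xb (star_curv X Y Z) q - star_curv X Y (bracket A xb Z) q) p"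
    by (rule vf_app_vf_trace[OF tensorial_star_curv[OF X Y] smooth_xb])
  also have "\<dots> = vf_trace A (\<lambda>Z q. (star_curv (bracket A xb X) Y Z q + star_curv X (bracket A xb Y) Z q)
      + (g q (f q (Y q)) (f q (Z q)) *\<^sub>R v q + g q (X q) (f q (Z q)) *\<^sub>R w q)) p"
  proof (rule vf_trace_cong)
    fix Z assume Z: "smooth_vf A Z"
    show "bracket A xb (star_curv X Y Z) p - star_curv X Y (bracket A xb Z) p
      = (star_curv (bracket A xb X) Y Z p + star_curv X (bracket A xb Y) Z p)
      + (g p (f p (Y p)) (f p (Z p)) *\<^sub>R v p + g p (X p) (f p (Z p)) *\<^sub>R w p)"
      using lie_curvature_xb[OF X smooth_f[OF Y] smooth_f[OF Z], of p]
      unfolding fbr[OF Y] fbr[OF Z]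
      by (simp add: tmetric_f et_simps proj_f v_def w_def power2_eq_square algebra_simps)
  qed
  also have "\<dots> = vf_trace A (star_curv (bracket A xb X) Y) p + vf_trace A (star_curv X (bracket A xb Y)) p
      + (g p (f p (Y p)) (f p (v p)) + g p (X p) (f p (w p)))"
  proof -
    have lin: "linear (\<lambda>z. g p u (f p z))" for u
      by (intro linearI) (simp_all add: f_simps metric_simps)
    show ?thesis
      unfolding vf_trace_add
      using vf_trace_rank_one[of "\<lambda>q z. g q (f q (Y q)) (f q z)" p v, OF lin]
        vf_trace_rank_one[of "\<lambda>q z. g q (X q) (f q z)" p w, OF lin]
      by simp
  qed
  also have "g p (f p (Y p)) (f p (v p)) = - 2 * K\<^sup>2 * \<beta> * g p (f p (X p)) (f p (Y p))"
    by (simp add: v_def f_simps f_xb f_proj metric_simps metric_sym[of p "f p (Y p)"] power2_eq_square)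
  also have "g p (X p) (f p (w p)) = - 2 * K\<^sup>2 * \<beta> * g p (f p (X p)) (f p (Y p))"
    by (simp add: w_def f_simps metric_simps f_skew power2_eq_square)
  finally show ?thesis by simp
qed

subsection \<open>Solitons\<close>

text \<open>The commutator of the Lie derivatives along \<open>xb\<close> and \<open>V\<close> is
  the one along their bracket. The last two lines are the Lie derivative along \<open>V\<close> of 2
  K \<open>tmetric\<close>.\<close>

lemma lie_deform:
  assumes V: "smooth_vf A V" and X: "smooth_vf A X" and Y: "smooth_vf A Y"
  shows "vf_app A xb (deform V X Y) p = deform V (bracket A xb X) Y p + deform V X (bracket A xb Y) p
    + deform (bracket A xb V) X Y p
    + 2 * K * (tmetric p (D X V p) (Y p) + tmetric p (X p) (D Y V p))
    - 2 * K * \<beta> * (tmetric p (X p) (V p) * et p (Y p) + tmetric p (Y p) (V p) * et p (X p))"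
proof -
  have "vf_app A xb (deform V X Y) p
    = g p (bracket A xb (D X V) p) (Y p) + g p (D X V p) (bracket A xb Y p)
      + 2 * K * tmetric p (D X V p) (Y p)
      + (g p (bracket A xb X p) (D Y V p) + g p (X p) (bracket A xb (D Y V) p)
      + 2 * K * tmetric p (X p) (D Y V p))"
    unfolding deform_def[abs_def] using assms by (simp add: vf_app_add smooth_metric smooth_D lie_metric)
  then show ?thesis
    unfolding bracket_D lie_D_xb[OF X V] lie_D_xb[OF Y V]
    by (simp add: deform_def metric_simps metric_sym[of p "xb p"] et_eq_metric algebra_simps)
qed

lemma soliton_constants_sum:
  assumes sol: "star_eta_ricci_soliton A s f \<eta> g D V lam mu" and \<beta>: "\<beta> \<noteq> 0"
  shows "lam + mu = 0"
proof -
  define c where "c = lam + mu"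
  define U where "U = bracket A xb V"
  define U' where "U' = bracket A xb U"
  have V: "smooth_vf A V" using sol by (simp add: star_eta_ricci_soliton_def)
  have U: "smooth_vf A U" and U': "smooth_vf A U'"
    unfolding U'_def U_def by (intro smooth_bracket smooth_xb V)+
  have K: "K \<noteq> 0" using \<beta> s_pos by simp
  \<comment> \<open>The soliton equation doubled, since \<open>star_ricci\<close> is half of the
    trace.\<close>
  have eq: "vf_trace A (star_curv X Y) p
      = 2 * lam * tmetric p (X p) (Y p) + 2 * c * (et p (X p) * et p (Y p)) - deform V X Y p"
    if "smooth_vf A X" "smooth_vf A Y" for X Y p
  proof -
    have "(1 / 2) * lie_deriv2 A V g X Y p + star_ricci A D f X Y p =
           lam * tmetric p (X p) (Y p) + (lam + mu) * (et p (X p) * et p (Y p))"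
      using sol that unfolding star_eta_ricci_soliton_def tmetric_def by blast
    then show ?thesis
      using that by (simp add: lie_deriv2_eq_deform V star_ricci_def c_def algebra_simps)
  qed
  \<comment> \<open>The Lie derivative of \<open>eq\<close> along \<open>xb\<close>, with
    \<open>eq\<close> used again for the bracketed arguments. The terms with \<open>c\<close> cancel
    because \<open>et\<close> is invariant along \<open>xb\<close>.\<close>
  have lie_eq: "deform U X Y p = 2 * K * (2 * lam * tmetric p (X p) (Y p)
      - (tmetric p (D X V p) (Y p) + tmetric p (X p) (D Y V p)))
      + 2 * K * \<beta> * (tmetric p (X p) (V p) * et p (Y p) + tmetric p (Y p) (V p) * et p (X p))
      + 4 * K\<^sup>2 * \<beta> * g p (f p (X p)) (f p (Y p))"
    if X: "smooth_vf A X" and Y: "smooth_vf A Y" for X Y p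
  proof -
    note sm = X Y V smooth_xb smooth_bracket smooth_tmetric smooth_et smooth_deform smooth_fun_mult
      smooth_fun_add smooth_fun_const smooth_fun_diff
    have fn: "vf_trace A (star_curv X Y)
      = (\<lambda>q. 2 * lam * tmetric q (X q) (Y q) + 2 * c * (et q (X q) * et q (Y q)) - deform V X Y q)"
      using eq[OF X Y] by auto
    have "vf_app A xb (vf_trace A (star_curv X Y)) p
      = 2 * lam * vf_app A xb (\<lambda>q. tmetric q (X q) (Y q)) p
        + 2 * c * (et p (bracket A xb X p) * et p (Y p) + et p (X p) * et p (bracket A xb Y p))
        - vf_app A xb (deform V X Y) p"
      unfolding fn by (simp add: vf_app_diff vf_app_add vf_app_cmult vf_app_mult lie_et sm)
    then show ?thesis
      unfolding lie_star_curv_trace[OF X Y] lie_tmetric[OF X Y] lie_deform[OF V X Y] U_def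
        eq[OF smooth_bracket[OF smooth_xb X] Y] eq[OF X smooth_bracket[OF smooth_xb Y]]
      by (simp add: algebra_simps)
  qed
  \<comment> \<open>On the image of \<open>f\<close> the terms with \<open>\<eta>\<close> drop out, and differentiating once
    more along \<open>xb\<close> eliminates the curvature.\<close>
  let ?f = "\<lambda>X q. f q (X q)"
  have fbr: "bracket A xb (?f X) = ?f (bracket A xb X)" if "smooth_vf A X" for X
    using lie_f[OF that] by auto
  have first: "deform U (?f X) (?f Y) p + 2 * K * deform V (?f X) (?f Y) p
      = 4 * K * lam * tmetric p (f p (X p)) (f p (Y p)) + 4 * K\<^sup>2 * \<beta> * g p (f p (f p (X p))) (f p (f p (Y p)))"
    if X: "smooth_vf A X" and Y: "smooth_vf A Y" for X Y p
    using lie_eq[OF smooth_f[OF X] smooth_f[OF Y], of p]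
    by (simp add: et_simps tmetric_f deform_def algebra_simps)
  have second: "deform U' (?f X) (?f Y) p + 2 * K * deform U (?f X) (?f Y) p = 0"
    if X: "smooth_vf A X" and Y: "smooth_vf A Y" for X Y p
  proof -
    let ?X' = "bracket A xb X" and ?Y' = "bracket A xb Y"
    have X': "smooth_vf A ?X'" and Y': "smooth_vf A ?Y'" by (intro smooth_bracket smooth_xb X Y)+
    note sm = X Y X' Y' U V smooth_xb smooth_f smooth_tmetric smooth_metric smooth_deform smooth_fun_mult
      smooth_fun_add smooth_fun_const smooth_fun_diff
    have "deform U (?f X) (?f Y) = (\<lambda>q. 4 * K * lam * tmetric q (f q (X q)) (f q (Y q))
        + 4 * K\<^sup>2 * \<beta> * g q (f q (f q (X q))) (f q (f q (Y q))) - 2 * K * deform V (?f X) (?f Y) q)"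
      using first[OF X Y] by (auto simp: algebra_simps)
    then have "vf_app A xb (deform U (?f X) (?f Y)) p
      = 4 * K * lam * vf_app A xb (\<lambda>q. tmetric q (f q (X q)) (f q (Y q))) p
        + 4 * K\<^sup>2 * \<beta> * vf_app A xb (\<lambda>q. g q (f q (f q (X q))) (f q (f q (Y q)))) p
        - 2 * K * vf_app A xb (deform V (?f X) (?f Y)) p"
      by (simp add: vf_app_diff vf_app_add vf_app_cmult sm)
    moreover have "vf_app A xb (\<lambda>q. tmetric q (f q (X q)) (f q (Y q))) p
      = tmetric p (f p (?X' p)) (f p (Y p)) + tmetric p (f p (X p)) (f p (?Y' p))
        + 2 * K * tmetric p (f p (X p)) (f p (Y p))"
      using lie_tmetric[OF smooth_f[OF X] smooth_f[OF Y]] by (simp add: fbr X Y)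
    moreover have "vf_app A xb (\<lambda>q. g q (f q (f q (X q))) (f q (f q (Y q)))) p
      = g p (f p (f p (?X' p))) (f p (f p (Y p))) + g p (f p (f p (X p))) (f p (f p (?Y' p)))
        + 2 * K * g p (f p (f p (X p))) (f p (f p (Y p)))"
      using lie_metric[OF smooth_f[OF smooth_f[OF X]] smooth_f[OF smooth_f[OF Y]]]
      by (simp add: fbr X Y smooth_f tmetric_f)
    moreover have "vf_app A xb (deform W (?f X) (?f Y)) p = deform W (?f ?X') (?f Y) p + deform W (?f X) (?f ?Y') p
      + deform (bracket A xb W) (?f X) (?f Y) p + 2 * K * deform W (?f X) (?f Y) p"
      if "smooth_vf A W" for W
      using lie_deform[OF that smooth_f[OF X] smooth_f[OF Y], of p]
      by (simp add: fbr X Y et_simps tmetric_f deform_def)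
    ultimately have "deform U (?f ?X') (?f Y) p + deform U (?f X) (?f ?Y') p
        + deform U' (?f X) (?f Y) p + 2 * K * deform U (?f X) (?f Y) p
      = 4 * K * lam * (tmetric p (f p (?X' p)) (f p (Y p)) + tmetric p (f p (X p)) (f p (?Y' p))
        + 2 * K * tmetric p (f p (X p)) (f p (Y p)))
      + 4 * K\<^sup>2 * \<beta> * (g p (f p (f p (?X' p))) (f p (f p (Y p))) + g p (f p (f p (X p))) (f p (f p (?Y' p)))
        + 2 * K * g p (f p (f p (X p))) (f p (f p (Y p))))
      - 2 * K * (deform V (?f ?X') (?f Y) p + deform V (?f X) (?f ?Y') p
      + deform U (?f X) (?f Y) p + 2 * K * deform V (?f X) (?f Y) p)"
      using U V by (simp add: U'_def U_def)
    \<comment> \<open>Differentiation has multiplied the right side of \<open>first\<close> by 2 K;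
      \<open>first\<close> itself turns that multiple back into deformations.\<close>
    moreover have "2 * K * (deform U (?f X) (?f Y) p + 2 * K * deform V (?f X) (?f Y) p)
      = 2 * K * (4 * K * lam * tmetric p (f p (X p)) (f p (Y p))
        + 4 * K\<^sup>2 * \<beta> * g p (f p (f p (X p))) (f p (f p (Y p))))"
      by (simp only: first[OF X Y])
    ultimately show ?thesis
      using first[OF X' Y, of p] first[OF X Y', of p] by (simp only: algebra_simps)
  qed
  have bxx: "bracket A xb xb = (\<lambda>q. 0)" by (auto simp: bracket_eq smooth_xb)
  have deform_V_xb: "deform V X xb p = 2 * c * s * et p (X p)" if X: "smooth_vf A X" for X p
  proof -
    \<comment> \<open>The second argument of the curvature is f xb = 0.\<close>
    have "star_curv X xb Z q = 0" if Z: "smooth_vf A Z" for Z q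
    proof -
      have "D (\<lambda>q. 0) (?f Z) = (\<lambda>q. 0)" "bracket A X (\<lambda>q. 0) = (\<lambda>q. 0)"
        using X Z by (auto simp: D_zero_left smooth_f bracket_zero)
      then show ?thesis using X Z by (simp add: f_xb curvature_def D_zero D_zero_left smooth_D smooth_f)
    qed
    then have "vf_trace A (star_curv X xb) p = vf_trace A (\<lambda>Z q. 0 *\<^sub>R Z q) p"
      by (intro vf_trace_cong) simp
    also have "\<dots> = 0" by (simp only: vf_trace_scale mult_zero_left)
    finally show ?thesis
      using eq[OF X smooth_xb, of p] by (simp add: tmetric_xb et_xb algebra_simps)
  qed
  \<comment> \<open>In \<open>lie_eq\<close> the derivative of \<open>V\<close> along
    \<open>xb\<close> is U plus K times the projection of \<open>V\<close>; the latter part cancels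
    against the \<beta> term, because et(xb) = s and s \<beta> = K.\<close>
  have deform_U_xb: "deform U X xb p = - 2 * K * tmetric p (X p) (U p)" if X: "smooth_vf A X" for X p
    using lie_eq[OF X smooth_xb, of p]
    by (simp add: D_along_xb[OF V] U_def tmetric_xb et_xb f_xb metric_simps tmetric_simps tmetric_proj
        algebra_simps power2_eq_square)
  \<comment> \<open>This value is the same at all points, which the next step
    differentiates.\<close>
  have et_U: "et p (U p) = c * s * s" for p
  proof -
    have "et p (U p) = g p (D xb V p) (xb p)"
      using metric_proj(1)[of p "V p" "xb p"]
      by (simp add: D_along_xb[OF V] U_def et_eq_metric metric_simps tmetric_xb)
    also have "\<dots> = deform V xb xb p / 2" by (simp add: deform_def metric_sym[of p "xb p"])
    finally show ?thesis by (simp add: deform_V_xb smooth_xb et_xb)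
  qed
  have U'_eq: "g p (X p) (U' p) = - 2 * K * tmetric p (X p) (U p)" if X: "smooth_vf A X" for X p
  proof -
    have "vf_app A X (\<lambda>q. g q (U q) (xb q)) p = 0"
      using et_U by (simp add: et_eq_metric)
    then have "g p (D X U p) (xb p) = - K * tmetric p (X p) (U p)"
      using X U by (simp add: metric_compatible smooth_xb D_xb metric_simps metric_proj tmetric_sym[of p "U p"])
    moreover have "g p (X p) (D xb U p) = g p (X p) (U' p) + K * tmetric p (X p) (U p)"
      by (simp add: D_along_xb[OF U] U'_def metric_simps metric_proj)
    ultimately show ?thesis
      using deform_U_xb[OF X, of p] by (simp add: deform_def)
  qed
  \<comment> \<open>Any point serves, as types are inhabited.\<close>
  define p where "p = (undefined :: 'm)"
  obtain w where w: "f p w \<noteq> 0"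
  proof (rule ccontr)
    assume "\<not> thesis"
    then have "range (f p) \<subseteq> {0}" using that by auto
    then have "dim (range (f p)) = 0" using dim_subset[of "range (f p)" "{0}"] by simp
    then show False using dim_range_f n_pos by simp
  qed
  obtain W where W: "smooth_vf A W" "W p = w" using extension_exists by blast
  define X where "X = ?f W"
  have X: "smooth_vf A X" unfolding X_def by (rule smooth_f[OF W(1)])
  have et_X: "et p (X p) = 0" by (simp add: X_def et_simps)
  have tX: "tmetric p y (X p) = g p y (X p)" "tmetric p (X p) y = g p (X p) y" for y
    by (simp_all add: X_def tmetric_f)
  have "deform U' X X p + 2 * K * deform U X X p = 0"
    unfolding X_def by (rule second[OF W(1) W(1)])
  then have 1: "g p (X p) (D X U' p) + 2 * K * g p (X p) (D X U p) = 0"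
    by (simp add: deform_def metric_sym[of p _ "X p"])
  \<comment> \<open>Differentiating the orthogonality relation \<open>U'_eq\<close> along
    \<open>X\<close> gives g(X, D X Z), half of the Lie derivative of \<open>g\<close> along Z,
    which vanishes by \<open>1\<close>. The terms with \<open>D X X\<close> cancel by
    \<open>U'_eq\<close> again, and the covariant derivative of \<open>tmetric\<close> leaves
    \<beta> g(X, X) et(U).\<close>
  have "vf_app A X (\<lambda>q. g q (X q) (U' q)) p = vf_app A X (\<lambda>q. (- 2 * K) * tmetric q (X q) (U q)) p"
    by (simp only: U'_eq[OF X])
  also have "\<dots> = (- 2 * K) * (tmetric p (D X X p) (U p) + g p (X p) (D X U p) - \<beta> * (g p (X p) (X p) * et p (U p)))"
    using X U by (simp only: vf_app_cmult smooth_tmetric deriv_tmetric) (simp add: et_X tX)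
  finally have "g p (X p) (D X U' p) + 2 * K * g p (X p) (D X U p) = 2 * K * (\<beta> * (g p (X p) (X p) * et p (U p)))"
    using U'_eq[OF smooth_D[OF X X], of p] X U'
    by (simp add: metric_compatible algebra_simps)
  then have "2 * K * (\<beta> * (g p (X p) (X p) * (c * s * s))) = 0"
    using 1 by (simp add: et_U)
  moreover have "g p (X p) (X p) > 0"
    using w W(2) by (intro metric_pos) (simp add: X_def)
  ultimately show ?thesis using K \<beta> s_pos by (simp add: c_def)
qed

end

theorem proposition5:
  fixes A :: "('m::{t2_space,second_countable_topology}, 'd::finite) chart set"
    and n s :: nat
    and f Q :: "('m, 'd) endo"
    and \<xi> :: "nat \<Rightarrow> ('m, 'd) vfield"
    and \<eta> :: "nat \<Rightarrow> ('m, 'd) form1"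
    and g :: "('m, 'd) form2"
    and D :: "('m, 'd) conn"
    and V :: "('m, 'd) vfield"
    and \<beta> lam mu :: real
  assumes "weak_beta_f_kenmotsu A n s f Q \<xi> \<eta> g D \<beta>"
    and "\<beta> \<noteq> 0"
    and "star_eta_ricci_soliton A s f \<eta> g D V lam mu"
  shows "lam + mu = 0"
proof -
  interpret weak_kenmotsu A g D n s f Q \<xi> \<eta> \<beta>
    using assms(1)
    by unfold_locales (auto simp: weak_beta_f_kenmotsu_def weak_metric_f_structure_def)
  show ?thesis by (rule soliton_constants_sum[OF assms(3,2)])
qed

end
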